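(* Let $X=C(K)$ for some compact Hausdorff space $K$ or $X=\ell^1(I)$ for some set $I$, let $B$ be any boundary for $X$, let $A\subseteq X$ be a bounded set and let $\varepsilon\geq 0$ be such that for every sequence $(x_n)_{n\in\mathbb{N}}$ in $A$ we have $$\bigcap_{k=1}^{\infty}\left(\overline{\operatorname{co}}^{\sigma_B}\{x_n : n\geq k\}+\varepsilon B_X\right)\neq\emptyset.$$ Then $A$ is $2\varepsilon$-WRC.
   Context: All Banach spaces are real; $C(K)$ is the space of real-valued continuous functions on $K$ with the supremum norm, and $\ell^1(I)$ is the space of absolutely summable real families indexed by $I$ with its usual norm. $B_X$ is the closed unit ball of $X$, $X^*$ its dual and $S_{X^*}$ the unit sphere of $X^*$. A subset $B\subseteq S_{X^*}$ is a boundary for $X$ if for every $x\in X$ there is some $b\in B$ with $b(x)=\|x\|$. $\sigma_B$ denotes the topology on $X$ of pointwise convergence on $B$; $\overline{\operatorname{co}}^{\sigma_B} C$ is the $\sigma_B$-closure of the convex hull of $C$. For $\delta\geq 0$, a bounded set $A\subseteq X$ is $\delta$-weakly relatively compact ($\delta$-WRC) if $\operatorname{dist}(x^{**},X)\leq\delta$ for every $x^{**}$ in the weak*-closure of $A$ in $X^{**}$ (with $X$ canonically embedded in $X^{**}$, and the distance taken in the norm of $X^{**}$). *)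

theory Defs
  imports "HOL-Analysis.Analysis"
begin

section \<open>The Banach space of absolutely summable real families\<close>

typedef 'i ell1 = "{f :: 'i \<Rightarrow> real. (\<lambda>i. \<bar>f i\<bar>) summable_on UNIV}"
  morphisms apply_ell1 Abs_ell1
  by (rule exI[of _ "\<lambda>_. 0"]) simp

setup_lifting type_definition_ell1

lemma ell1_add_summable:
  fixes f g :: "'i \<Rightarrow> real"
  assumes "(\<lambda>i. \<bar>f i\<bar>) summable_on UNIV" "(\<lambda>i. \<bar>g i\<bar>) summable_on UNIV"
  shows "(\<lambda>i. \<bar>f i + g i\<bar>) summable_on UNIV"
  by (rule summable_on_comparison_test[OF summable_on_add[OF assms]]) auto

lemma ell1_scale_summable:
  fixes f :: "'i \<Rightarrow> real"
  assumes "(\<lambda>i. \<bar>f i\<bar>) summable_on UNIV"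
  shows "(\<lambda>i. \<bar>c * f i\<bar>) summable_on UNIV"
  using summable_on_cmult_right[OF assms, of "\<bar>c\<bar>"] by (simp add: abs_mult)

instantiation ell1 :: (type) real_vector
begin

lift_definition zero_ell1 :: "'a ell1" is "\<lambda>_. 0"
  by simp

lift_definition plus_ell1 :: "'a ell1 \<Rightarrow> 'a ell1 \<Rightarrow> 'a ell1" is "\<lambda>f g i. f i + g i"
  by (rule ell1_add_summable)

lift_definition uminus_ell1 :: "'a ell1 \<Rightarrow> 'a ell1" is "\<lambda>f i. - f i"
  by simp

lift_definition minus_ell1 :: "'a ell1 \<Rightarrow> 'a ell1 \<Rightarrow> 'a ell1" is "\<lambda>f g i. f i - g i"
proof -
  fix f g :: "'a \<Rightarrow> real"
  assume "(\<lambda>i. \<bar>f i\<bar>) summable_on UNIV" "(\<lambda>i. \<bar>g i\<bar>) summable_on UNIV"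
  then show "(\<lambda>i. \<bar>f i - g i\<bar>) summable_on UNIV"
    using ell1_add_summable[of f "\<lambda>i. - g i"] by simp
qed

lift_definition scaleR_ell1 :: "real \<Rightarrow> 'a ell1 \<Rightarrow> 'a ell1" is "\<lambda>c f i. c * f i"
  by (rule ell1_scale_summable)

instance
  by standard (transfer; simp add: algebra_simps fun_eq_iff)+

end

instantiation ell1 :: (type) real_normed_vector
begin

lift_definition norm_ell1 :: "'a ell1 \<Rightarrow> real" is "\<lambda>f. \<Sum>\<^sub>\<infinity>i. \<bar>f i\<bar>" .

definition dist_ell1 :: "'a ell1 \<Rightarrow> 'a ell1 \<Rightarrow> real"
  where "dist_ell1 x y = norm (x - y)"

definition sgn_ell1 :: "'a ell1 \<Rightarrow> 'a ell1"
  where "sgn_ell1 x = x /\<^sub>R norm x"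

definition uniformity_ell1 :: "('a ell1 \<times> 'a ell1) filter"
  where "uniformity_ell1 = (INF e\<in>{0 <..}. principal {(x, y). dist x y < e})"

definition open_ell1 :: "'a ell1 set \<Rightarrow> bool"
  where "open_ell1 S = (\<forall>x\<in>S. \<forall>\<^sub>F (x', y) in uniformity. x' = x \<longrightarrow> y \<in> S)"

instance
proof
  fix x y :: "'a ell1" and c :: real
  show "norm x = 0 \<longleftrightarrow> x = 0"
  proof
    assume z: "norm x = 0"
    have s: "(\<lambda>i. \<bar>apply_ell1 x i\<bar>) summable_on UNIV" using apply_ell1[of x] by simp
    have le: "(\<Sum>\<^sub>\<infinity>i. \<bar>apply_ell1 x i\<bar>) \<le> 0" using z by (simp add: norm_ell1.rep_eq)
    have "\<bar>apply_ell1 x i\<bar> = 0" for i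
      by (rule nonneg_infsum_le_0D[OF le s]) simp_all
    then have "apply_ell1 x = apply_ell1 0" by (simp add: zero_ell1.rep_eq fun_eq_iff)
    then show "x = 0" by (simp add: apply_ell1_inject)
  qed (transfer, simp)
  show "norm (x + y) \<le> norm x + norm y"
  proof transfer
    fix f g :: "'a \<Rightarrow> real"
    assume s: "(\<lambda>i. \<bar>f i\<bar>) summable_on UNIV" "(\<lambda>i. \<bar>g i\<bar>) summable_on UNIV"
    then have "(\<Sum>\<^sub>\<infinity>i. \<bar>f i + g i\<bar>) \<le> (\<Sum>\<^sub>\<infinity>i. \<bar>f i\<bar> + \<bar>g i\<bar>)"
      by (intro infsum_mono ell1_add_summable summable_on_add) auto
    also have "\<dots> = (\<Sum>\<^sub>\<infinity>i. \<bar>f i\<bar>) + (\<Sum>\<^sub>\<infinity>i. \<bar>g i\<bar>)"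
      using s by (intro infsum_add) auto
    finally show "(\<Sum>\<^sub>\<infinity>i. \<bar>f i + g i\<bar>) \<le> (\<Sum>\<^sub>\<infinity>i. \<bar>f i\<bar>) + (\<Sum>\<^sub>\<infinity>i. \<bar>g i\<bar>)" .
  qed
  show "norm (c *\<^sub>R x) = \<bar>c\<bar> * norm x"
    by transfer (simp add: abs_mult infsum_cmult_right')
qed (simp_all add: dist_ell1_def sgn_ell1_def uniformity_ell1_def open_ell1_def)

end

lemma ell1_sum_le_norm: "finite F \<Longrightarrow> (\<Sum>i\<in>F. \<bar>apply_ell1 x i\<bar>) \<le> norm x"
  by transfer (auto intro: finite_sum_le_infsum)

lemma ell1_apply_diff: "apply_ell1 (x - y) i = apply_ell1 x i - apply_ell1 y i"
  by transfer simp

lemma ell1_norm_le: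
  assumes "\<And>F. finite F \<Longrightarrow> (\<Sum>i\<in>F. \<bar>apply_ell1 x i\<bar>) \<le> e"
  shows "norm x \<le> e"
  using assms by transfer (auto intro!: infsum_le_finite_sums)

instance ell1 :: (type) banach
proof
  fix X :: "nat \<Rightarrow> 'a ell1"
  assume C: "Cauchy X"
  have "\<exists>l. (\<lambda>n. apply_ell1 (X n) i) \<longlonglongrightarrow> l" for i
  proof -
    have le: "\<bar>apply_ell1 (X m) i - apply_ell1 (X n) i\<bar> \<le> norm (X m - X n)" for m n
      using ell1_sum_le_norm[of "{i}" "X m - X n"] by (simp add: ell1_apply_diff)
    have "Cauchy (\<lambda>n. apply_ell1 (X n) i)"
    proof (rule metric_CauchyI)
      fix e :: real assume "e > 0"
      from metric_CauchyD[OF C this] obtain M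
        where M: "\<And>m n. m \<ge> M \<Longrightarrow> n \<ge> M \<Longrightarrow> dist (X m) (X n) < e" by blast
      have "dist (apply_ell1 (X m) i) (apply_ell1 (X n) i) < e" if "m \<ge> M" "n \<ge> M" for m n
        using le[of m n] M[OF that] by (simp add: dist_norm)
      then show "\<exists>M. \<forall>m\<ge>M. \<forall>n\<ge>M. dist (apply_ell1 (X m) i) (apply_ell1 (X n) i) < e" by blast
    qed
    then show ?thesis by (simp add: Cauchy_convergent_iff convergent_def)
  qed
  then obtain L where L: "\<And>i. (\<lambda>n. apply_ell1 (X n) i) \<longlonglongrightarrow> L i" by metis
  have key: "\<exists>N. \<forall>m\<ge>N. \<forall>F. finite F \<longrightarrow> (\<Sum>i\<in>F. \<bar>apply_ell1 (X m) i - L i\<bar>) \<le> e" if "e > 0" for e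
  proof -
    obtain N where N: "\<And>m n. m \<ge> N \<Longrightarrow> n \<ge> N \<Longrightarrow> norm (X m - X n) < e"
      using metric_CauchyD[OF C \<open>e > 0\<close>] unfolding dist_norm by blast
    have "(\<Sum>i\<in>F. \<bar>apply_ell1 (X m) i - L i\<bar>) \<le> e" if "m \<ge> N" "finite F" for m F
    proof (rule LIMSEQ_le_const2)
      show "(\<lambda>n. \<Sum>i\<in>F. \<bar>apply_ell1 (X m) i - apply_ell1 (X n) i\<bar>)
              \<longlonglongrightarrow> (\<Sum>i\<in>F. \<bar>apply_ell1 (X m) i - L i\<bar>)"
        by (intro tendsto_intros L)
      show "\<exists>M. \<forall>n\<ge>M. (\<Sum>i\<in>F. \<bar>apply_ell1 (X m) i - apply_ell1 (X n) i\<bar>) \<le> e"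
      proof (intro exI[of _ N] allI impI)
        fix n assume "n \<ge> N"
        show "(\<Sum>i\<in>F. \<bar>apply_ell1 (X m) i - apply_ell1 (X n) i\<bar>) \<le> e"
          using ell1_sum_le_norm[OF that(2), of "X m - X n"] N[OF that(1) \<open>n \<ge> N\<close>]
          by (simp add: ell1_apply_diff)
      qed
    qed
    then show ?thesis by blast
  qed
  obtain N where N: "\<And>F. finite F \<Longrightarrow> (\<Sum>i\<in>F. \<bar>apply_ell1 (X N) i - L i\<bar>) \<le> 1"
    using key[of 1] by fastforce
  have d: "(\<lambda>i. \<bar>L i - apply_ell1 (X N) i\<bar>) summable_on UNIV"
  proof (rule nonneg_bdd_above_summable_on)
    show "bdd_above (sum (\<lambda>i. \<bar>L i - apply_ell1 (X N) i\<bar>) ` {F. F \<subseteq> UNIV \<and> finite F})"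
      by (rule bdd_aboveI[of _ 1]) (use N in \<open>auto simp: abs_minus_commute[of "L _"]\<close>)
  qed simp
  have "(\<lambda>i. \<bar>L i\<bar>) summable_on UNIV"
    using ell1_add_summable[OF d, of "apply_ell1 (X N)"] apply_ell1[of "X N"] by simp
  then have AL: "apply_ell1 (Abs_ell1 L) = L" by (simp add: Abs_ell1_inverse)
  have "X \<longlonglongrightarrow> Abs_ell1 L"
  proof (rule metric_LIMSEQ_I)
    fix r :: real assume "r > 0"
    then obtain N where N: "\<And>m F. m \<ge> N \<Longrightarrow> finite F \<Longrightarrow>
        (\<Sum>i\<in>F. \<bar>apply_ell1 (X m) i - L i\<bar>) \<le> r / 2"
      using key[of "r / 2"] by auto
    have "norm (X m - Abs_ell1 L) \<le> r / 2" if "m \<ge> N" for m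
      by (rule ell1_norm_le) (use N[OF that] in \<open>simp add: ell1_apply_diff AL\<close>)
    then show "\<exists>no. \<forall>n\<ge>no. dist (X n) (Abs_ell1 L) < r"
      using \<open>r > 0\<close> unfolding dist_norm by fastforce
  qed
  then show "convergent X" by (auto simp: convergent_def)
qed

section \<open>Boundaries and weak relative compactness\<close>

definition boundary :: "('a::real_normed_vector \<Rightarrow>\<^sub>L real) set \<Rightarrow> bool" where
  "boundary B \<longleftrightarrow> B \<subseteq> sphere 0 1 \<and> (\<forall>x. \<exists>b\<in>B. blinfun_apply b x = norm x)"

definition sigma_topology :: "('a::real_normed_vector \<Rightarrow>\<^sub>L real) set \<Rightarrow> 'a topology" where
  "sigma_topology B =
     pullback_topology UNIV (\<lambda>x. \<lambda>b\<in>B. blinfun_apply b x) (product_topology (\<lambda>_. euclidean) B)"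

lift_definition bidual_embedding :: "'a::real_normed_vector \<Rightarrow> ('a \<Rightarrow>\<^sub>L real) \<Rightarrow>\<^sub>L real"
  is "\<lambda>x f. blinfun_apply f x"
  by (rule blinfun.bounded_linear_left)

text \<open>On the bidual, regarded as the space of operators from the dual to the reals,
  the strong operator topology is pointwise convergence on the dual, i.e. the weak* topology.\<close>

definition delta_WRC :: "real \<Rightarrow> 'a::real_normed_vector set \<Rightarrow> bool" where
  "delta_WRC \<delta> A \<longleftrightarrow> bounded A \<and>
     (\<forall>\<phi> \<in> strong_operator_topology closure_of (bidual_embedding ` A).
        infdist \<phi> (range bidual_embedding) \<le> \<delta>)"

end

theory Submission
  imports Defs
begin

text \<open>
  Both spaces carry a compact space \<open>E\<close> of norm-one functionals on which every norm is attained: the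
  signed point evaluations \<open>K \<times> {1, -1}\<close> for \<open>C(K)\<close>, the sign vectors \<open>{1, -1}\<^sup>I\<close> for \<open>\<ell>\<^sup>1(I)\<close>. An
  arbitrary boundary \<open>B\<close> need not meet \<open>E\<close>, but it imitates \<open>E\<close> on countable sets: for countable \<open>D\<close> and
  \<open>e \<in> E\<close> some \<open>b \<in> B\<close> agrees with \<open>e\<close> on \<open>D\<close> (\<open>boundary_simulates_points\<close>, \<open>boundary_simulates_signs\<close>).
  The reason is that one vector can be built whose norm is attained only by functionals which behave
  like \<open>e\<close> on all of \<open>D\<close>. As the hypothesis concerns one sequence and one vector \<open>y\<close> at a time, it
  yields for every \<open>e \<in> E\<close>, up to \<open>\<epsilon>\<close>, that \<open>y(e)\<close> lies between the lower and the upper limit of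
  \<open>x\<^sub>n(e)\<close> (\<open>asymptotic_bounds\<close>).

  Suppose that some \<open>\<phi>\<close> in the weak* closure of \<open>A\<close> has distance more than \<open>d > 2 \<epsilon>\<close> from \<open>X\<close>. Helly's
  theorem produces a triangular array: \<open>f\<^sub>m\<close> in the dual ball and \<open>x\<^sub>n \<in> A\<close> with \<open>f\<^sub>m(x\<^sub>n) > d\<close> for
  \<open>m \<le> n\<close> and \<open>f\<^sub>m(x\<^sub>n) = 0\<close> for \<open>n < m\<close> (\<open>triangular_system\<close>). Were the \<open>f\<^sub>m\<close> points of \<open>E\<close>, the vector
  \<open>y\<close> belonging to \<open>(x\<^sub>n)\<close> would be at least \<open>d - \<epsilon>\<close> at each \<open>f\<^sub>m\<close> and at most \<open>\<epsilon>\<close> at a cluster point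
  of them, which contradicts \<open>d > 2 \<epsilon>\<close>.

  In general \<open>f\<^sub>m\<close> is only an average of points of \<open>E\<close>: by the Hahn-Banach theorem it extends to a mean,
  that is, a positive normalised functional on \<open>C(E)\<close>. The core of the proof is to pass from means to
  points with an arbitrarily small loss of the gap \<open>d\<close> (\<open>double_limit_extraction\<close>). The tool is a Fatou
  lemma for means on a compact space, a consequence of Simons' inequality: if all \<open>\<mu>(h\<^sub>n) \<ge> c\<close>, then
  some single point \<open>e\<close> has \<open>h\<^sub>n(e)\<close> almost as large as \<open>c\<close> for infinitely many \<open>n\<close>. First \<open>e\<close> is
  chosen so that \<open>x\<^sub>k(e)\<close> is small for infinitely many \<open>k\<close>, and so that for each neighbourhood of \<open>e\<close>
  given by finitely many \<open>x\<^sub>k\<close> the event that \<open>x\<^sub>n\<close> is large there keeps positive mass in the iterated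
  limit. Then points \<open>e\<^sub>i\<close> tending to \<open>e\<close> are chosen one after the other, each time thinning the
  sequence to those \<open>n\<close> for which \<open>x\<^sub>n(e\<^sub>i)\<close> is large. The diagonal subsequence of \<open>(x\<^sub>n)\<close> together with
  \<open>e\<^sub>i\<close> and \<open>e\<close> then plays the role of the array above.
\<close>

section \<open>Sublinear functionals and the Hahn-Banach theorem\<close>

definition sublinear :: "('v::real_vector \<Rightarrow> real) \<Rightarrow> bool" where
  "sublinear p \<longleftrightarrow>
     (\<forall>u v. p (u + v) \<le> p u + p v) \<and> (\<forall>c u. c \<ge> 0 \<longrightarrow> p (c *\<^sub>R u) = c * p u)"

lemma sublinearI:
  assumes "\<And>u v. p (u + v) \<le> p u + p v"
    and "\<And>c u. c > 0 \<Longrightarrow> p (c *\<^sub>R u) \<le> c * p u" and "p 0 = 0"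
  shows "sublinear p"
proof -
  have "p (c *\<^sub>R u) = c * p u" if "c \<ge> 0" for c u
  proof (cases "c = 0")
    case False
    with that have c: "c > 0" by simp
    have "p u \<le> inverse c * p (c *\<^sub>R u)"
      using assms(2)[of "inverse c" "c *\<^sub>R u"] c by simp
    then have "c * p u \<le> p (c *\<^sub>R u)"
      using c by (simp add: field_simps)
    with assms(2)[OF c, of u] show ?thesis by simp
  qed (simp add: assms(3))
  with assms(1) show ?thesis by (simp add: sublinear_def)
qed

lemma sublinear_add: "sublinear p \<Longrightarrow> p (u + v) \<le> p u + p v"
  by (simp add: sublinear_def)

lemma sublinear_scale: "sublinear p \<Longrightarrow> c \<ge> 0 \<Longrightarrow> p (c *\<^sub>R u) = c * p u"
  by (simp add: sublinear_def)

lemma sublinear_0: "sublinear p \<Longrightarrow> p 0 = 0"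
  using sublinear_scale[of p 0 0] by simp

lemma sublinear_lower:
  assumes "sublinear p" shows "- p (- v) \<le> p v"
  using sublinear_add[OF assms, of v "- v"] sublinear_0[OF assms] by simp

text \<open>
  The infimal convolution \<open>v \<mapsto> inf\<^sub>x (f x + p (v - T x))\<close> is the greatest sublinear functional below \<open>p\<close>
  that stays below \<open>f\<close> on the image of the cone \<open>S\<close>. With a subspace for \<open>S\<close> it prepares the
  extension of \<open>f\<close>; with a ray it is the step that makes minimal functionals additive.
\<close>

lemma sublinear_infimal_convolution:
  fixes p :: "'v::real_vector \<Rightarrow> real" and T :: "'x::real_vector \<Rightarrow> 'v"
  assumes p: "sublinear p" and T: "linear T" and f: "linear f"
    and S: "0 \<in> S" "\<And>x y. x \<in> S \<Longrightarrow> y \<in> S \<Longrightarrow> x + y \<in> S"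
      "\<And>c x. c > 0 \<Longrightarrow> x \<in> S \<Longrightarrow> c *\<^sub>R x \<in> S"
    and dom: "\<And>x. x \<in> S \<Longrightarrow> - f x \<le> p (- T x)"
  obtains r where "sublinear r" "\<And>v. r v \<le> p v" "\<And>x. x \<in> S \<Longrightarrow> r (T x) \<le> f x"
proof -
  define r where "r v = (INF x\<in>S. f x + p (v - T x))" for v
  have bdd: "bdd_below ((\<lambda>x. f x + p (v - T x)) ` S)" for v
  proof (rule bdd_belowI2[of _ "- p (- v)"])
    fix x assume "x \<in> S"
    have "p (- T x) \<le> p (v - T x) + p (- v)"
      using sublinear_add[OF p, of "v - T x" "- v"] by simp
    with dom[OF \<open>x \<in> S\<close>] show "- p (- v) \<le> f x + p (v - T x)" by linarith
  qed
  have le: "r v \<le> f x + p (v - T x)" if "x \<in> S" for v x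
    unfolding r_def by (rule cINF_lower[OF bdd that])
  have ge: "c \<le> r v" if "\<And>x. x \<in> S \<Longrightarrow> c \<le> f x + p (v - T x)" for v c
    unfolding r_def using S(1) that by (intro cINF_greatest) auto
  have T0: "T 0 = 0" "f 0 = 0" using T f by (simp_all add: linear_0)
  have rp: "r v \<le> p v" for v using le[OF S(1), of v] by (simp add: T0)
  have "sublinear r"
  proof (rule sublinearI)
    fix u v
    have "r (u + v) - (f x + p (u - T x)) \<le> r v" if x: "x \<in> S" for x
    proof (rule ge)
      fix y assume y: "y \<in> S"
      have "r (u + v) \<le> f (x + y) + p (u + v - T (x + y))" by (rule le[OF S(2)[OF x y]])
      also have "p (u + v - T (x + y)) \<le> p (u - T x) + p (v - T y)"
        using sublinear_add[OF p, of "u - T x" "v - T y"]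
        by (simp add: linear_add[OF T] algebra_simps)
      finally show "r (u + v) - (f x + p (u - T x)) \<le> f y + p (v - T y)"
        by (simp add: linear_add[OF f])
    qed
    then have "r (u + v) - r v \<le> r u" by (intro ge) (auto simp: algebra_simps)
    then show "r (u + v) \<le> r u + r v" by simp
  next
    fix c :: real and u assume c: "c > 0"
    have "inverse c * r (c *\<^sub>R u) \<le> r u"
    proof (rule ge)
      fix x assume x: "x \<in> S"
      have "r (c *\<^sub>R u) \<le> f (c *\<^sub>R x) + p (c *\<^sub>R u - T (c *\<^sub>R x))" by (rule le[OF S(3)[OF c x]])
      also have "\<dots> = c * (f x + p (u - T x))"
        using c sublinear_scale[OF p, of c "u - T x"]
        by (simp add: linear_scale[OF f] linear_scale[OF T] algebra_simps)
      finally show "inverse c * r (c *\<^sub>R u) \<le> f x + p (u - T x)"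
        using c by (simp add: field_simps)
    qed
    then show "r (c *\<^sub>R u) \<le> c * r u" using c by (simp add: field_simps)
  next
    have "0 \<le> r 0" by (rule ge) (use dom in force)
    with rp[of 0] show "r 0 = 0" by (simp add: sublinear_0[OF p])
  qed
  moreover have "r (T x) \<le> f x" if "x \<in> S" for x
    using le[OF that, of "T x"] by (simp add: sublinear_0[OF p])
  ultimately show thesis using rp that by blast
qed

text \<open>
  Zorn's lemma applies because the pointwise infimum of a chain of sublinear functionals below \<open>p\<close>
  is finite, being bounded below by \<open>- p (- v)\<close>, and again sublinear, since any two members of
  the chain have a common lower bound in it.
\<close>

lemma minimal_sublinear_exists:
  fixes p :: "'v::real_vector \<Rightarrow> real"
  assumes p: "sublinear p"
  shows "\<exists>q. sublinear q \<and> (\<forall>v. q v \<le> p v) \<and>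
    (\<forall>r. sublinear r \<longrightarrow> (\<forall>v. r v \<le> q v) \<longrightarrow> r = q)"
proof -
  define A where "A = {q. sublinear q \<and> (\<forall>v. q v \<le> p v)}"
  define P where "P = (\<lambda>a b :: 'v \<Rightarrow> real. b \<le> a)"
  have "\<exists>m\<in>A. \<forall>a\<in>A. P m a \<longrightarrow> a = m"
  proof (rule predicate_Zorn)
    show "partial_order_on A (relation_of P A)"
      by (auto simp: partial_order_on_def preorder_on_def refl_on_def trans_def antisym_def
          relation_of_def P_def intro: order.trans)
    fix C assume "C \<in> Chains (relation_of P A)"
    then have CA: "C \<subseteq> A" and chain: "\<And>a b. a \<in> C \<Longrightarrow> b \<in> C \<Longrightarrow> a \<le> b \<or> b \<le> a"
      by (fastforce simp: Chains_def relation_of_def P_def)+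
    show "\<exists>u\<in>A. \<forall>a\<in>C. P a u"
    proof (cases "C = {}")
      case True
      then show ?thesis using p by (auto simp: A_def)
    next
      case False
      define u where "u v = (INF q\<in>C. q v)" for v
      have low: "- p (- v) \<le> q v" if "q \<in> C" for q v
      proof -
        have "sublinear q" "q (- v) \<le> p (- v)" using CA that by (auto simp: A_def)
        with sublinear_lower[of q v] show ?thesis by linarith
      qed
      have le: "u v \<le> q v" if "q \<in> C" for q v
        unfolding u_def by (rule cINF_lower[OF bdd_belowI2[OF low] that])
      have ge: "c \<le> u v" if "\<And>q. q \<in> C \<Longrightarrow> c \<le> q v" for c v
        unfolding u_def using False that by (intro cINF_greatest) auto
      have Csub: "sublinear q" if "q \<in> C" for q using CA that by (auto simp: A_def)
      have "sublinear u"
      proof (rule sublinearI)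
        fix v w
        have "u (v + w) - a v \<le> u w" if a: "a \<in> C" for a
        proof (rule ge)
          fix b assume b: "b \<in> C"
          obtain c where c: "c \<in> C" "c \<le> a" "c \<le> b"
            using chain[OF a b] a b by blast
          have "u (v + w) \<le> c (v + w)" by (rule le[OF c(1)])
          also have "\<dots> \<le> c v + c w" by (rule sublinear_add[OF Csub[OF c(1)]])
          also have "\<dots> \<le> a v + b w" using c by (intro add_mono) (auto simp: le_fun_def)
          finally show "u (v + w) - a v \<le> b w" by simp
        qed
        then have "u (v + w) - u w \<le> u v" by (intro ge) (auto simp: algebra_simps)
        then show "u (v + w) \<le> u v + u w" by simp
      next
        fix c :: real and v assume c: "c > 0"
        have "inverse c * u (c *\<^sub>R v) \<le> u v"
        proof (rule ge)
          fix q assume q: "q \<in> C"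
          have "u (c *\<^sub>R v) \<le> c * q v"
            using le[OF q, of "c *\<^sub>R v"] sublinear_scale[OF Csub[OF q], of c v] c by simp
          then show "inverse c * u (c *\<^sub>R v) \<le> q v" using c by (simp add: field_simps)
        qed
        then show "u (c *\<^sub>R v) \<le> c * u v" using c by (simp add: field_simps)
      next
        have "(\<lambda>q. q 0) ` C = {0}" using False sublinear_0[OF Csub] by force
        then show "u 0 = 0" by (simp add: u_def)
      qed
      moreover have "u v \<le> p v" for v
      proof -
        obtain q where "q \<in> C" using False by blast
        with CA have "q v \<le> p v" by (auto simp: A_def)
        with le[OF \<open>q \<in> C\<close>, of v] show ?thesis by simp
      qed
      ultimately have "u \<in> A" by (simp add: A_def)
      with le show ?thesis by (auto simp: P_def le_fun_def)
    qed
  qed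
  then obtain m where m: "m \<in> A" "\<And>a. a \<in> A \<Longrightarrow> a \<le> m \<Longrightarrow> a = m" by (auto simp: P_def)
  show ?thesis
  proof (intro exI conjI allI impI)
    show "sublinear m" "\<And>v. m v \<le> p v" using m(1) by (auto simp: A_def)
    fix r assume r: "sublinear r" "\<forall>v. r v \<le> m v"
    then have "r v \<le> p v" for v using m(1) order.trans by (fastforce simp: A_def)
    with r show "r = m" by (intro m(2)) (auto simp: A_def le_fun_def)
  qed
qed

text \<open>
  Pushing \<open>q\<close> down along the ray opposite to \<open>w\<close> gives a sublinear \<open>r \<le> q\<close> with \<open>r (- w) \<le> - q w\<close>;
  minimality forces \<open>q (- w) = - q w\<close>, and additivity follows.
\<close>

lemma minimal_sublinear_linear:
  fixes q :: "'v::real_vector \<Rightarrow> real"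
  assumes q: "sublinear q"
    and min: "\<And>r. sublinear r \<Longrightarrow> (\<And>v. r v \<le> q v) \<Longrightarrow> r = q"
  shows "linear q"
proof -
  have add: "q (v + w) = q v + q w" for v w
  proof -
    have T: "linear (\<lambda>t. - (t *\<^sub>R w))" and f: "linear (\<lambda>t. - (t * q w))"
      by (auto simp: linear_iff algebra_simps)
    obtain r where r: "sublinear r" "\<And>v. r v \<le> q v"
      "\<And>t. t \<in> {0..} \<Longrightarrow> r (- (t *\<^sub>R w)) \<le> - (t * q w)"
      by (rule sublinear_infimal_convolution[OF q T f, of "{0..}"])
        (use sublinear_scale[OF q] in auto)
    have "r = q" by (rule min) (use r in auto)
    with r(3)[of 1] have "q (- w) \<le> - q w" by simp
    moreover have "q v \<le> q (v + w) + q (- w)" using sublinear_add[OF q, of "v + w" "- w"] by simp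
    ultimately show ?thesis using sublinear_add[OF q, of v w] by simp
  qed
  have neg: "q (- v) = - q v" for v using add[of v "- v"] sublinear_0[OF q] by simp
  have "q (c *\<^sub>R v) = c * q v" for c v
  proof (cases "c \<ge> 0")
    case False
    then show ?thesis using sublinear_scale[OF q, of "- c" v] neg[of "c *\<^sub>R v"] by simp
  qed (simp add: sublinear_scale[OF q])
  with add show ?thesis by (simp add: linear_iff)
qed

text \<open>
  A minimal sublinear functional below the infimal convolution of \<open>p\<close> and \<open>f\<close> is linear and at most
  \<open>f\<close> on \<open>T ` S\<close>; both being odd there, they agree. The map \<open>T\<close> allows the domain of \<open>f\<close> to be given
  as a parametrised subspace of another space.
\<close>

lemma Hahn_Banach_dominated:
  fixes p :: "'v::real_vector \<Rightarrow> real" and T :: "'x::real_vector \<Rightarrow> 'v"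
  assumes p: "sublinear p" and T: "linear T" and f: "linear f" and S: "subspace S"
    and dom: "\<And>x. x \<in> S \<Longrightarrow> f x \<le> p (T x)"
  obtains F where "linear F" "\<And>v. F v \<le> p v" "\<And>x. x \<in> S \<Longrightarrow> F (T x) = f x"
proof -
  have dom': "- f x \<le> p (- T x)" if "x \<in> S" for x
    using dom[OF subspace_neg[OF S that]] by (simp add: linear_neg[OF T] linear_neg[OF f])
  obtain r where r: "sublinear r" "\<And>v. r v \<le> p v" "\<And>x. x \<in> S \<Longrightarrow> r (T x) \<le> f x"
    by (rule sublinear_infimal_convolution[OF p T f, of S])
      (use S dom' in \<open>auto simp: subspace_0 subspace_add subspace_scale\<close>)
  obtain F where F: "sublinear F" "\<And>v. F v \<le> r v"
    "\<And>s. sublinear s \<Longrightarrow> (\<And>v. s v \<le> F v) \<Longrightarrow> s = F"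
    using minimal_sublinear_exists[OF r(1)] by blast
  have lin: "linear F" by (rule minimal_sublinear_linear[OF F(1) F(3)])
  have le: "F (T x) \<le> f x" if "x \<in> S" for x
    using F(2)[of "T x"] r(3)[OF that] by simp
  have "F (T x) = f x" if "x \<in> S" for x
    using le[OF that] le[OF subspace_neg[OF S that]]
    by (simp add: linear_neg[OF T] linear_neg[OF f] linear_neg[OF lin])
  moreover have "F v \<le> p v" for v using F(2)[of v] r(2)[of v] by simp
  ultimately show thesis using lin that by blast
qed

section \<open>Functionals far from the canonical image of a normed space\<close>

text \<open>
  Induction on the number of functionals: a vector on which the last one is 1 and the others vanish
  allows the last one to be subtracted off.
\<close>

lemma linear_functional_eq_combination:
  fixes L :: "'v::real_vector \<Rightarrow> real" and g :: "nat \<Rightarrow> 'v \<Rightarrow> real"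
  assumes "\<And>i. i < k \<Longrightarrow> linear (g i)" and "linear L"
    and "\<And>v. (\<And>i. i < k \<Longrightarrow> g i v = 0) \<Longrightarrow> L v = 0"
  shows "\<exists>c. \<forall>v. L v = (\<Sum>i<k. c i * g i v)"
  using assms
proof (induction k arbitrary: L)
  case 0
  then show ?case by simp
next
  case (Suc k)
  note g = Suc.prems(1) and L = Suc.prems(2)
  show ?case
  proof (cases "\<forall>v. (\<forall>i<k. g i v = 0) \<longrightarrow> g k v = 0")
    case True
    then have "L v = 0" if "\<And>i. i < k \<Longrightarrow> g i v = 0" for v
      using that Suc.prems(3)[of v] by (metis less_Suc_eq)
    with Suc.IH[of L] g L obtain c where c: "\<And>v. L v = (\<Sum>i<k. c i * g i v)" by auto
    have "L v = (\<Sum>i<Suc k. (c(k := 0)) i * g i v)" for v by (simp add: c)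
    then show ?thesis by blast
  next
    case False
    then obtain v1 where v1: "\<And>i. i < k \<Longrightarrow> g i v1 = 0" "g k v1 \<noteq> 0" by blast
    define w where "w = v1 /\<^sub>R g k v1"
    have w: "\<And>i. i < k \<Longrightarrow> g i w = 0" "g k w = 1"
      using v1 g by (auto simp: w_def linear_scale)
    define M where "M v = L v - L w * g k v" for v
    have "linear M"
      using L g[of k] by (auto simp: M_def linear_iff algebra_simps)
    moreover have "M v = 0" if "\<And>i. i < k \<Longrightarrow> g i v = 0" for v
    proof -
      have "L (v - g k v *\<^sub>R w) = 0"
      proof (rule Suc.prems(3))
        fix i assume "i < Suc k"
        then show "g i (v - g k v *\<^sub>R w) = 0"
          using that[of i] w g[of i] by (cases "i = k") (auto simp: linear_diff linear_scale)
      qed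
      then show ?thesis by (simp add: M_def linear_diff[OF L] linear_scale[OF L] mult.commute)
    qed
    ultimately obtain c where c: "\<And>v. M v = (\<Sum>i<k. c i * g i v)" using Suc.IH[of M] g by auto
    have "L v = (\<Sum>i<Suc k. (c(k := L w)) i * g i v)" for v
      using c[of v] by (simp add: M_def)
    then show ?thesis by blast
  qed
qed

text \<open>
  If \<open>\<phi> f \<le> d * norm f\<close> held on the whole annihilator of the \<open>x i\<close>, an extension \<open>F\<close> of this
  restriction would have norm at most \<open>d\<close>. The difference \<open>\<phi> - F\<close> vanishes on the annihilator of
  finitely many vectors, hence is the evaluation at a combination of them, and \<open>\<phi>\<close> would be within
  \<open>d\<close> of that vector.
\<close>

lemma Helly_annihilator:
  fixes \<phi> :: "('x::real_normed_vector \<Rightarrow>\<^sub>L real) \<Rightarrow>\<^sub>L real" and x :: "nat \<Rightarrow> 'x"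
  assumes far: "d < infdist \<phi> (range bidual_embedding)" and d: "0 \<le> d"
  obtains f where "norm f \<le> 1" "\<And>i. i < k \<Longrightarrow> blinfun_apply f (x i) = 0" "d < blinfun_apply \<phi> f"
proof -
  define S where "S = {f :: 'x \<Rightarrow>\<^sub>L real. \<forall>i<k. blinfun_apply f (x i) = 0}"
  have S: "subspace S"
    by (auto simp: S_def subspace_def blinfun.add_left blinfun.scaleR_left)
  have lin\<phi>: "linear (blinfun_apply \<phi>)" by (rule bounded_linear.linear[OF blinfun.bounded_linear_right])
  have "\<exists>f\<in>S. d * norm f < blinfun_apply \<phi> f"
  proof (rule ccontr)
    assume "\<not> ?thesis"
    then have dom: "blinfun_apply \<phi> f \<le> d * norm f" if "f \<in> S" for f using that by force
    have "sublinear (\<lambda>f :: 'x \<Rightarrow>\<^sub>L real. d * norm f)"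
      using d by (intro sublinearI)
        (auto simp: distrib_left[symmetric] intro!: mult_left_mono norm_triangle_ineq)
    from Hahn_Banach_dominated[OF this linear_id lin\<phi> S, unfolded id_apply, OF dom]
    obtain F where F: "linear F" "\<And>f. F f \<le> d * norm f" "\<And>f. f \<in> S \<Longrightarrow> F f = blinfun_apply \<phi> f"
      by metis
    have abs: "\<bar>F f\<bar> \<le> d * norm f" for f
      using F(2)[of f] F(2)[of "- f"] by (simp add: linear_neg[OF F(1)])
    define L where "L f = blinfun_apply \<phi> f - F f" for f
    have "linear L" using lin\<phi> F(1) by (auto simp: L_def linear_iff algebra_simps)
    moreover have "linear (\<lambda>f :: 'x \<Rightarrow>\<^sub>L real. blinfun_apply f (x i))" for i
      by (auto simp: linear_iff blinfun.add_left blinfun.scaleR_left)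
    moreover have "L f = 0" if "\<And>i. i < k \<Longrightarrow> blinfun_apply f (x i) = 0" for f
      using F(3)[of f] that by (simp add: L_def S_def)
    ultimately obtain c where c: "\<And>f. L f = (\<Sum>i<k. c i * blinfun_apply f (x i))"
      using linear_functional_eq_combination[of k "\<lambda>i f. blinfun_apply f (x i)" L] by auto
    define z where "z = (\<Sum>i<k. c i *\<^sub>R x i)"
    have z: "blinfun_apply (bidual_embedding z) f = L f" for f
      by (simp add: c z_def bidual_embedding.rep_eq blinfun.sum_right blinfun.scaleR_right)
    have "norm (\<phi> - bidual_embedding z) \<le> d"
    proof (rule norm_blinfun_bound[OF d])
      fix f show "norm (blinfun_apply (\<phi> - bidual_embedding z) f) \<le> d * norm f"
        using abs[of f] by (simp add: blinfun.diff_left z L_def)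
    qed
    then have "infdist \<phi> (range bidual_embedding) \<le> d"
      using infdist_le[of "bidual_embedding z" "range bidual_embedding" \<phi>]
      by (simp add: dist_norm)
    with far show False by simp
  qed
  then obtain f where f: "f \<in> S" "d * norm f < blinfun_apply \<phi> f" by blast
  then have f0: "norm f > 0" by auto
  show thesis
  proof (rule that[of "f /\<^sub>R norm f"])
    show "norm (f /\<^sub>R norm f) \<le> 1" using f0 by simp
    show "blinfun_apply (f /\<^sub>R norm f) (x i) = 0" if "i < k" for i
      using f(1) that by (simp add: S_def blinfun.scaleR_left)
    show "d < blinfun_apply \<phi> (f /\<^sub>R norm f)"
      using f(2) f0 by (simp add: blinfun.scaleR_right field_simps)
  qed
qed

text \<open>
  The array is built by alternation: \<open>f n\<close> annihilates the earlier vectors while \<open>\<phi>\<close> exceeds \<open>d\<close> at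
  it, and \<open>x n\<close> approximates \<open>\<phi>\<close> on \<open>f 0, \<dots>, f n\<close>.
\<close>

lemma triangular_system:
  fixes \<phi> :: "('x::real_normed_vector \<Rightarrow>\<^sub>L real) \<Rightarrow>\<^sub>L real"
  assumes \<phi>: "\<phi> \<in> strong_operator_topology closure_of (bidual_embedding ` A)"
    and far: "d < infdist \<phi> (range bidual_embedding)" and d: "0 \<le> d"
  obtains f :: "nat \<Rightarrow> 'x \<Rightarrow>\<^sub>L real" and x :: "nat \<Rightarrow> 'x"
  where "\<And>m. norm (f m) \<le> 1" "\<And>n. x n \<in> A"
    "\<And>m n. n < m \<Longrightarrow> blinfun_apply (f m) (x n) = 0"
    "\<And>m n. m \<le> n \<Longrightarrow> d < blinfun_apply (f m) (x n)"
proof -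
  define Q where "Q s n r \<longleftrightarrow> norm (fst r) \<le> 1 \<and> snd r \<in> A \<and> d < blinfun_apply \<phi> (fst r) \<and>
      d < blinfun_apply (fst r) (snd r) \<and>
      (\<forall>k<n. blinfun_apply (fst r) (snd (s k)) = 0 \<and> d < blinfun_apply (fst (s k)) (snd r))"
    for s :: "nat \<Rightarrow> ('x \<Rightarrow>\<^sub>L real) \<times> 'x" and n r
  have "\<exists>s. \<forall>n. Q s n (s n)"
  proof (rule dependent_wellorder_choice)
    fix r and s t :: "nat \<Rightarrow> ('x \<Rightarrow>\<^sub>L real) \<times> 'x" and n :: nat
    assume "\<And>k. k < n \<Longrightarrow> s k = t k"
    then show "Q s n r = Q t n r" by (simp add: Q_def)
  next
    fix n :: nat and s assume IH: "\<And>k. k < n \<Longrightarrow> Q s k (s k)"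
    obtain f where f: "norm f \<le> 1" "\<And>i. i < n \<Longrightarrow> blinfun_apply f (snd (s i)) = 0"
      "d < blinfun_apply \<phi> f"
      using Helly_annihilator[OF far d, of n "\<lambda>i. snd (s i)"] by blast
    define G where "G = insert f ((\<lambda>k. fst (s k)) ` {..<n})"
    define U where "U = {\<psi> :: ('x \<Rightarrow>\<^sub>L real) \<Rightarrow>\<^sub>L real. \<forall>g\<in>G. blinfun_apply \<psi> g \<in> {d<..}}"
    have "openin strong_operator_topology U"
      unfolding U_def by (rule strong_operator_topology_basis) (auto simp: G_def)
    moreover have "\<phi> \<in> U" using f(3) IH by (auto simp: U_def G_def Q_def)
    ultimately obtain x where x: "x \<in> A" "bidual_embedding x \<in> U"
      using \<phi> by (auto simp: in_closure_of)
    then have "Q s n (f, x)"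
      using f by (auto simp: Q_def U_def G_def bidual_embedding.rep_eq)
    then show "\<exists>r. Q s n r" by blast
  qed
  then obtain s where s: "\<And>n. Q s n (s n)" by blast
  show thesis
  proof (rule that[of "\<lambda>m. fst (s m)" "\<lambda>n. snd (s n)"])
    fix m n :: nat
    show "norm (fst (s m)) \<le> 1" "snd (s n) \<in> A" using s by (auto simp: Q_def)
    show "blinfun_apply (fst (s m)) (snd (s n)) = 0" if "n < m" using s[of m] that by (auto simp: Q_def)
    show "d < blinfun_apply (fst (s m)) (snd (s n))" if "m \<le> n"
      using s[of n] that by (cases "m = n") (auto simp: Q_def)
  qed
qed

section \<open>Simons' inequality\<close>

text \<open>
  The proof by a nearly minimising sequence: \<open>g k\<close> is chosen in the convex hull of the \<open>h n\<close> with
  \<open>n \<ge> k\<close> so that continuing the partial sum \<open>fs g k\<close> of \<open>\<Sum>\<^sub>i 2\<^sup>-\<^sup>i\<^sup>-\<^sup>1 g i\<close> by the constant tail \<open>g k\<close>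
  makes the maximum almost as small as any other tail would. At a maximum point \<open>b\<close> of the full
  series this optimality prevents the normalised remainder \<open>2\<^sup>k D k\<close> from dropping much
  below its initial value, which is at least \<open>c\<close>. The remainder is an average of later \<open>h n\<close> at \<open>b\<close>, so some of
  these exceed \<open>c'\<close>.
\<close>

lemma Simons_inequality:
  fixes h :: "nat \<Rightarrow> 'e::topological_space \<Rightarrow>\<^sub>C real"
  assumes comp: "compact (UNIV :: 'e set)"
    and bdd: "\<And>n. norm (h n) \<le> C"
    and big: "\<And>u. u \<in> convex hull (range h) \<Longrightarrow> \<exists>e. c \<le> apply_bcontfun u e"
    and c': "c' < c"
  shows "\<exists>e. infinite {n. c' < apply_bcontfun (h n) e}"
proof -
  define S where "S u = (SUP e. apply_bcontfun u e)" for u :: "'e \<Rightarrow>\<^sub>C real"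
  define Co where "Co k = convex hull (h ` {k..})" for k :: nat
  \<comment> \<open>The slack \<open>\<eta> k\<close> is multiplied by \<open>2 ^ k\<close> below, and the products still sum to \<open>(c - c') / 2\<close>.\<close>
  define \<eta> where "\<eta> k = (c - c') / 4 * (1/4) ^ k" for k :: nat
  define fs where "fs s k = (\<Sum>i<k. (1/2) ^ Suc i *\<^sub>R s i)" for s :: "nat \<Rightarrow> 'e \<Rightarrow>\<^sub>C real" and k
  have S_upper: "apply_bcontfun u e \<le> S u" for u e
    unfolding S_def by (rule cSUP_upper) (auto intro: bounded_imp_bdd_above)
  have S_least: "S u \<le> b" if "\<And>e. apply_bcontfun u e \<le> b" for u b
    unfolding S_def using that by (intro cSUP_least) auto
  have S_le: "S u \<le> S v + norm (u - v)" for u v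
  proof (rule S_least)
    fix e show "apply_bcontfun u e \<le> S v + norm (u - v)"
      using S_upper[of v e] norm_bounded[of "u - v" e] by simp
  qed
  have C0: "C \<ge> 0" using bdd[of 0] norm_ge_zero order.trans by blast
  have Co_norm: "norm u \<le> C" if "u \<in> Co k" for u k
  proof -
    have "convex hull (h ` {k..}) \<subseteq> cball 0 C"
      by (rule hull_minimal) (auto simp: bdd)
    with that show ?thesis by (auto simp: Co_def)
  qed
  have Co_mono: "Co l \<subseteq> Co k" if "k \<le> l" for k l
    unfolding Co_def using that by (intro hull_mono) auto
  have Co_ne: "h k \<in> Co k" for k by (auto simp: Co_def intro: hull_inc)
  have Co_conv: "convex (Co k)" for k by (simp add: Co_def)
  define P where "P s k r \<longleftrightarrow> r \<in> Co k \<and>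
      (\<forall>u\<in>Co k. S (fs s k + (1/2) ^ k *\<^sub>R r) \<le> S (fs s k + (1/2) ^ k *\<^sub>R u) + \<eta> k)" for s k r
  have "\<exists>g. \<forall>k. P g k (g k)"
  proof (rule dependent_wellorder_choice)
    fix r and s t :: "nat \<Rightarrow> 'e \<Rightarrow>\<^sub>C real" and k :: nat
    assume "\<And>i. i < k \<Longrightarrow> s i = t i"
    then have "fs s k = fs t k" by (simp add: fs_def)
    then show "P s k r = P t k r" by (simp add: P_def)
  next
    fix k :: nat and s :: "nat \<Rightarrow> 'e \<Rightarrow>\<^sub>C real"
    define V where "V u = S (fs s k + (1/2) ^ k *\<^sub>R u)" for u
    have low: "S (fs s k) - C \<le> V u" if "u \<in> Co k" for u
    proof -
      have "(1/2) ^ k * norm u \<le> 1 * C"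
        using Co_norm[OF that] C0 by (intro mult_mono) (auto intro: power_le_one)
      then show ?thesis
        using S_le[of "fs s k" "fs s k + (1/2) ^ k *\<^sub>R u"] by (simp add: V_def)
    qed
    have bb: "bdd_below (V ` Co k)" by (rule bdd_belowI2[OF low])
    have "Inf (V ` Co k) < Inf (V ` Co k) + \<eta> k" using c' by (simp add: \<eta>_def)
    with Co_ne[of k] bb obtain r where r: "r \<in> Co k" "V r < Inf (V ` Co k) + \<eta> k"
      by (subst (asm) cINF_less_iff) auto
    have "V r \<le> V u + \<eta> k" if "u \<in> Co k" for u
      using cINF_lower[OF bb that] r(2) by simp
    with r(1) show "\<exists>r. P s k r" by (auto simp: P_def V_def)
  qed
  then obtain g where g: "\<And>k. P g k (g k)" by blast
  have gCo: "g k \<in> Co k" for k using g by (simp add: P_def)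
  define F where "F N = fs g N + (1/2) ^ N *\<^sub>R g N" for N
  \<comment> \<open>Following the \<open>g i\<close> up to \<open>N\<close> and filling up with a constant tail \<open>v\<close> gives an admissible
    competitor for \<open>g k\<close>.\<close>
  have mix: "(2::real) ^ k *\<^sub>R (fs g N - fs g k) + (2 ^ k * (1/2) ^ N) *\<^sub>R v \<in> Co k"
    if "k \<le> N" "v \<in> Co N" for k N v
    using that
  proof (induction N arbitrary: v rule: dec_induct)
    case base
    then show ?case by (simp add: power_mult_distrib[symmetric])
  next
    case (step N)
    have v: "v \<in> Co N" using step.prems Co_mono[of N "Suc N"] by auto
    have "(1/2) *\<^sub>R g N + (1/2) *\<^sub>R v \<in> Co N"
      using convexD[OF Co_conv gCo v, of "1/2" "1/2"] by simp
    from step.IH[OF this] show ?case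
      by (simp add: fs_def scaleR_add_right scaleR_diff_right algebra_simps)
  qed
  have F_mix: "\<exists>u\<in>Co k. F N = fs g k + (1/2) ^ k *\<^sub>R u" if "k \<le> N" for k N
  proof (rule bexI[OF _ mix[OF that gCo]])
    have "(1/2) ^ k * (2::real) ^ k = 1" by (simp add: power_mult_distrib[symmetric])
    then show "F N = fs g k + (1/2) ^ k *\<^sub>R
        ((2::real) ^ k *\<^sub>R (fs g N - fs g k) + (2 ^ k * (1/2) ^ N) *\<^sub>R g N)"
      by (simp add: F_def scaleR_add_right mult.assoc[symmetric])
  qed
  have F_opt: "apply_bcontfun (F k) e \<le> S (F N) + \<eta> k" if kN: "k \<le> N" for k N e
  proof -
    obtain u where u: "u \<in> Co k" "F N = fs g k + (1/2) ^ k *\<^sub>R u" using F_mix[OF kN] by blast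
    have "S (F k) \<le> S (F N) + \<eta> k" using g[of k] u by (simp add: P_def F_def)
    then show ?thesis using S_upper[of "F k" e] by simp
  qed
  have F_step: "norm (F (Suc N) - F N) \<le> C * (1/2) ^ N" for N
  proof -
    have eq: "F (Suc N) - F N = (1/2) ^ Suc N *\<^sub>R (g (Suc N) - g N)"
      by (simp add: F_def fs_def algebra_simps flip: scaleR_add_left)
    have "norm (g (Suc N) - g N) \<le> C + C"
      using norm_triangle_ineq4[of "g (Suc N)" "g N"] Co_norm[OF gCo, of "Suc N"] Co_norm[OF gCo, of N]
      by linarith
    then have "(1/2) ^ Suc N * norm (g (Suc N) - g N) \<le> (1/2) ^ Suc N * (C + C)"
      by (rule mult_left_mono) simp
    then show ?thesis by (simp add: eq)
  qed
  have F_tail: "\<bar>apply_bcontfun (F (N + j)) e - apply_bcontfun (F N) e\<bar> \<le> 2 * C * (1/2) ^ N" for N j e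
  proof -
    have "\<bar>apply_bcontfun (F (N + j)) e - apply_bcontfun (F N) e\<bar>
        \<le> 2 * C * (1/2) ^ N * (1 - (1/2) ^ j)"
    proof (induction j)
      case (Suc j)
      have "\<bar>apply_bcontfun (F (Suc (N + j))) e - apply_bcontfun (F (N + j)) e\<bar> \<le> C * (1/2) ^ (N + j)"
        using norm_bounded[of "F (Suc (N + j)) - F (N + j)" e] F_step[of "N + j"] by simp
      with Suc show ?case by (simp add: power_add algebra_simps)
    qed simp
    also have "\<dots> \<le> 2 * C * (1/2) ^ N * 1" using C0 by (intro mult_left_mono) auto
    finally show ?thesis by simp
  qed
  define f where "f e = lim (\<lambda>N. apply_bcontfun (F N) e)" for e
  have half0: "(\<lambda>N. K * (1/2) ^ N) \<longlonglongrightarrow> 0" for K :: real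
    by (intro tendsto_mult_right_zero LIMSEQ_realpow_zero) auto
  have conv: "(\<lambda>N. apply_bcontfun (F N) e) \<longlonglongrightarrow> f e" for e
  proof -
    have "Cauchy (\<lambda>N. apply_bcontfun (F N) e)"
    proof (rule metric_CauchyI)
      fix r :: real assume "r > 0"
      with order_tendstoD(2)[OF half0[of "2 * C"], of "r / 2"] obtain N where N: "2 * C * (1/2) ^ N < r / 2"
        by (auto simp: eventually_sequentially)
      have near: "\<bar>apply_bcontfun (F m) e - apply_bcontfun (F N) e\<bar> < r / 2" if "m \<ge> N" for m
        using le_less_trans[OF F_tail[of N "m - N" e] N] that by simp
      have "dist (apply_bcontfun (F m) e) (apply_bcontfun (F n) e) < r" if "m \<ge> N" "n \<ge> N" for m n
        using near[OF that(1)] near[OF that(2)] unfolding dist_real_def by linarith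
      then show "\<exists>M. \<forall>m\<ge>M. \<forall>n\<ge>M. dist (apply_bcontfun (F m) e) (apply_bcontfun (F n) e) < r"
        by blast
    qed
    then show ?thesis unfolding f_def by (simp add: Cauchy_convergent_iff convergent_LIMSEQ_iff)
  qed
  have f_near: "\<bar>f e - apply_bcontfun (F N) e\<bar> \<le> 2 * C * (1/2) ^ N" for e N
  proof (rule LIMSEQ_le_const2)
    show "(\<lambda>j. \<bar>apply_bcontfun (F (j + N)) e - apply_bcontfun (F N) e\<bar>)
        \<longlonglongrightarrow> \<bar>f e - apply_bcontfun (F N) e\<bar>"
      by (intro tendsto_intros LIMSEQ_ignore_initial_segment conv)
    show "\<exists>M. \<forall>j\<ge>M. \<bar>apply_bcontfun (F (j + N)) e - apply_bcontfun (F N) e\<bar> \<le> 2 * C * (1/2) ^ N"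
      using F_tail[of N _ e] by (simp add: add.commute)
  qed
  have "continuous_on UNIV f"
  proof (rule uniform_limit_theorem)
    show "\<forall>\<^sub>F N in sequentially. continuous_on UNIV (apply_bcontfun (F N))" by simp
    show "uniform_limit UNIV (\<lambda>N. apply_bcontfun (F N)) f sequentially"
    proof (rule uniform_limitI)
      fix r :: real assume "r > 0"
      from order_tendstoD(2)[OF half0[of "2 * C"] this]
      show "\<forall>\<^sub>F N in sequentially. \<forall>e\<in>UNIV. dist (apply_bcontfun (F N) e) (f e) < r"
      proof eventually_elim
        case (elim N)
        show ?case
        proof
          fix e show "dist (apply_bcontfun (F N) e) (f e) < r"
            using le_less_trans[OF f_near[of e N] elim] by (subst dist_commute) (simp add: dist_real_def)
        qed
      qed
    qed
  qed simp
  then obtain b where b: "\<And>e. f e \<le> f b"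
    using continuous_attains_sup[OF comp] by auto
  have SF: "S (F N) \<le> f b + 2 * C * (1/2) ^ N" for N
  proof (rule S_least)
    fix e show "apply_bcontfun (F N) e \<le> f b + 2 * C * (1/2) ^ N"
      using f_near[of e N] b[of e] by linarith
  qed
  have lim_SF: "(\<lambda>N. f b + 2 * C * (1/2) ^ N) \<longlonglongrightarrow> f b"
    using tendsto_add[OF tendsto_const half0[of "2 * C"], of "f b"] by simp
  have Fb: "apply_bcontfun (F k) b \<le> f b + \<eta> k" for k
  proof -
    have "apply_bcontfun (F k) b - \<eta> k \<le> f b"
    proof (rule LIMSEQ_le_const[OF lim_SF])
      have "apply_bcontfun (F k) b - \<eta> k \<le> f b + 2 * C * (1/2) ^ N" if "k \<le> N" for N
        using F_opt[OF that, of b] SF[of N] by linarith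
      then show "\<exists>M. \<forall>N\<ge>M. apply_bcontfun (F k) b - \<eta> k \<le> f b + 2 * C * (1/2) ^ N" by blast
    qed
    then show ?thesis by simp
  qed
  have "c \<le> f b"
  proof (rule LIMSEQ_le_const[OF lim_SF])
    have "c \<le> f b + 2 * C * (1/2) ^ N" for N
    proof -
      obtain u where "u \<in> Co 0" "F N = u" using F_mix[of 0 N] by (auto simp: fs_def)
      then obtain e where "c \<le> apply_bcontfun (F N) e" using big[of u] by (auto simp: Co_def atLeast_0)
      with S_upper[of "F N" e] SF[of N] show ?thesis by linarith
    qed
    then show "\<exists>M. \<forall>N\<ge>M. c \<le> f b + 2 * C * (1/2) ^ N" by blast
  qed
  define D where "D k = f b - apply_bcontfun (fs g k) b" for k
  have D_low: "2 ^ k * D k \<ge> c - (c - c') / 2 * (1 - (1/2) ^ k)" for k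
  proof (induction k)
    case 0
    then show ?case using \<open>c \<le> f b\<close> by (simp add: D_def fs_def)
  next
    case (Suc k)
    have "D k \<le> 2 * D (Suc k) + \<eta> k"
      using Fb[of k] by (simp add: D_def F_def fs_def)
    then have "2 ^ k * D k \<le> 2 ^ k * (2 * D (Suc k) + \<eta> k)" by simp
    also have "\<dots> = 2 ^ Suc k * D (Suc k) + 2 ^ k * \<eta> k" by (simp add: algebra_simps)
    also have "2 ^ k * \<eta> k = (c - c') / 4 * (1/2) ^ k"
    proof -
      have "(2::real) ^ k * (1/4) ^ k = (1/2) ^ k" by (subst power_mult_distrib[symmetric]) simp
      then show ?thesis by (simp add: \<eta>_def)
    qed
    finally have "c - (c - c') / 2 * (1 - (1/2) ^ k) - (c - c') / 4 * (1/2) ^ k \<le> 2 ^ Suc k * D (Suc k)"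
      using Suc by linarith
    also have "c - (c - c') / 2 * (1 - (1/2) ^ k) - (c - c') / 4 * (1/2) ^ k
        = c - (c - c') / 2 * (1 - (1/2) ^ Suc k)"
      by (simp add: field_simps)
    finally show ?case .
  qed
  have "\<exists>n\<ge>k. c' < apply_bcontfun (h n) b" for k
  proof (rule ccontr)
    assume "\<not> ?thesis"
    then have hb: "apply_bcontfun (h n) b \<le> c'" if "n \<ge> k" for n using that by force
    have "Co k \<subseteq> {u. apply_bcontfun u b \<le> c'}"
      unfolding Co_def
    proof (rule hull_minimal)
      show "convex {u. apply_bcontfun u b \<le> c'}"
        by (auto simp: convex_alt intro: convex_bound_le)
    qed (use hb in auto)
    then have "apply_bcontfun (F N) b \<le> apply_bcontfun (fs g k) b + (1/2) ^ k * c'" if "k \<le> N" for N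
      using F_mix[OF that] by (auto intro!: mult_left_mono)
    then have "f b \<le> apply_bcontfun (fs g k) b + (1/2) ^ k * c'"
      by (intro LIMSEQ_le_const2[OF conv]) blast
    then have "D k \<le> (1/2) ^ k * c'" by (simp add: D_def)
    then have "2 ^ k * D k \<le> c'" by (simp add: field_simps)
    moreover have "(c - c') / 2 * (1 - (1/2) ^ k) \<le> (c - c') / 2 * 1"
      using c' by (intro mult_left_mono) auto
    then have "c - (c - c') / 2 \<le> 2 ^ k * D k" using D_low[of k] by linarith
    ultimately have "c - (c - c') / 2 \<le> c'" by linarith
    then show False using c' by (simp add: field_simps)
  qed
  then have "infinite {n. c' < apply_bcontfun (h n) b}"
    unfolding infinite_nat_iff_unbounded_le by blast
  then show ?thesis by blast
qed

section \<open>Means on a compact space and their Fatou lemma\<close>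

text \<open>
  A mean acts on all functions but is constrained only on the continuous ones; on a compact Hausdorff
  space its restriction to these is the integral with respect to a regular probability measure.
\<close>

definition mean :: "(('e::topological_space \<Rightarrow> real) \<Rightarrow> real) \<Rightarrow> bool" where
  "mean \<mu> \<longleftrightarrow>
     (\<forall>f g. continuous_on UNIV f \<longrightarrow> continuous_on UNIV g \<longrightarrow> \<mu> (\<lambda>e. f e + g e) = \<mu> f + \<mu> g) \<and>
     (\<forall>c f. continuous_on UNIV f \<longrightarrow> \<mu> (\<lambda>e. c * f e) = c * \<mu> f) \<and>
     (\<forall>f g. continuous_on UNIV f \<longrightarrow> continuous_on UNIV g \<longrightarrow> (\<forall>e. f e \<le> g e) \<longrightarrow> \<mu> f \<le> \<mu> g) \<and>
     \<mu> (\<lambda>_. 1) = 1"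

lemma mean_add:
  "mean \<mu> \<Longrightarrow> continuous_on UNIV f \<Longrightarrow> continuous_on UNIV g \<Longrightarrow> \<mu> (\<lambda>e. f e + g e) = \<mu> f + \<mu> g"
  by (simp add: mean_def)

lemma mean_cmult: "mean \<mu> \<Longrightarrow> continuous_on UNIV f \<Longrightarrow> \<mu> (\<lambda>e. c * f e) = c * \<mu> f"
  by (simp add: mean_def)

lemma mean_mono:
  "mean \<mu> \<Longrightarrow> continuous_on UNIV f \<Longrightarrow> continuous_on UNIV g \<Longrightarrow> (\<And>e. f e \<le> g e) \<Longrightarrow> \<mu> f \<le> \<mu> g"
  by (simp add: mean_def)

lemma mean_const: "mean \<mu> \<Longrightarrow> \<mu> (\<lambda>_. c) = c"
  using mean_cmult[of \<mu> "\<lambda>_. 1" c] by (simp add: mean_def)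

lemma mean_sum:
  assumes "mean \<mu>" "finite I" "\<And>i. i \<in> I \<Longrightarrow> continuous_on UNIV (f i)"
  shows "\<mu> (\<lambda>e. \<Sum>i\<in>I. f i e) = (\<Sum>i\<in>I. \<mu> (f i))"
  using assms(2,3)
proof (induction I rule: finite_induct)
  case empty
  then show ?case using mean_const[OF assms(1), of 0] by simp
next
  case (insert i I)
  then show ?case
    using mean_add[OF assms(1), of "f i" "\<lambda>e. \<Sum>i\<in>I. f i e"] by (simp add: continuous_on_sum)
qed

lemma mean_diff:
  assumes "mean \<mu>" "continuous_on UNIV f" "continuous_on UNIV g"
  shows "\<mu> (\<lambda>e. f e - g e) = \<mu> f - \<mu> g"
  using mean_add[OF assms(1,2), of "\<lambda>e. -1 * g e"] mean_cmult[OF assms(1,3), of "-1"] assms(3)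
  by (simp add: continuous_on_minus)

lemma mean_abs_le:
  assumes "mean \<mu>" "continuous_on UNIV f" "\<And>e. \<bar>f e\<bar> \<le> C"
  shows "\<bar>\<mu> f\<bar> \<le> C"
  using mean_mono[OF assms(1,2), of "\<lambda>_. C"] mean_mono[OF assms(1) _ assms(2), of "\<lambda>_. - C"]
    mean_const[OF assms(1)] assms(3) by (simp add: abs_le_iff minus_le_iff)

text \<open>
  Simons' inequality with the convex hull replaced by any convex class \<open>Q\<close>. This form also covers
  classes defined by an iterated limit of means, for which no single mean is at hand.
\<close>

lemma Simons_convex_class:
  fixes h :: "nat \<Rightarrow> 'e::topological_space \<Rightarrow> real"
  assumes comp: "compact (UNIV :: 'e set)"
    and cont: "\<And>n. continuous_on UNIV (h n)" and bdd: "\<And>n e. \<bar>h n e\<bar> \<le> C"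
    and hQ: "\<And>n. h n \<in> Q"
    and Q_conv: "\<And>f g s t. continuous_on UNIV f \<Longrightarrow> continuous_on UNIV g \<Longrightarrow> f \<in> Q \<Longrightarrow> g \<in> Q \<Longrightarrow>
      0 \<le> s \<Longrightarrow> 0 \<le> t \<Longrightarrow> s + t = 1 \<Longrightarrow> (\<lambda>e. s * f e + t * g e) \<in> Q"
    and Q_big: "\<And>f. continuous_on UNIV f \<Longrightarrow> f \<in> Q \<Longrightarrow> \<exists>e. c \<le> f e"
    and c': "c' < c"
  shows "\<exists>e. infinite {n. c' < h n e}"
proof -
  have ap: "apply_bcontfun (Bcontfun (h n)) = h n" for n
    using bcontfun_normI[OF cont, of n C] bdd by (simp add: Bcontfun_inverse)
  have "convex hull (range (\<lambda>n. Bcontfun (h n))) \<subseteq> {u. apply_bcontfun u \<in> Q}"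
  proof (rule hull_minimal)
    show "convex {u. apply_bcontfun u \<in> Q}"
    proof (rule convexI)
      fix u v :: "'e \<Rightarrow>\<^sub>C real" and s t :: real
      assume "u \<in> {u. apply_bcontfun u \<in> Q}" "v \<in> {u. apply_bcontfun u \<in> Q}"
        "0 \<le> s" "0 \<le> t" "s + t = 1"
      moreover have "apply_bcontfun (s *\<^sub>R u + t *\<^sub>R v)
          = (\<lambda>e. s * apply_bcontfun u e + t * apply_bcontfun v e)" by auto
      ultimately show "s *\<^sub>R u + t *\<^sub>R v \<in> {u. apply_bcontfun u \<in> Q}"
        using Q_conv by simp
    qed
  qed (auto simp: ap hQ)
  then have "\<exists>e. infinite {n. c' < apply_bcontfun (Bcontfun (h n)) e}"
    by (intro Simons_inequality[OF comp _ _ c', of _ C] norm_bound Q_big) (auto simp: ap bdd)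
  then show ?thesis by (simp add: ap)
qed

text \<open>
  Fatou's lemma without countable additivity: the functions whose mean is at least \<open>c\<close> form a convex
  class, each member of which comes close to \<open>c\<close> somewhere.
\<close>

lemma mean_Fatou:
  fixes h :: "nat \<Rightarrow> 'e::topological_space \<Rightarrow> real"
  assumes comp: "compact (UNIV :: 'e set)" and \<mu>: "mean \<mu>" and N: "infinite N"
    and cont: "\<And>n. continuous_on UNIV (h n)" and bdd: "\<And>n e. \<bar>h n e\<bar> \<le> C"
    and big: "\<And>n. n \<in> N \<Longrightarrow> c \<le> \<mu> (h n)" and c': "c' < c"
  shows "\<exists>e. infinite {n \<in> N. c' < h n e}"
proof -
  have "\<exists>e. infinite {n. c' < h (enumerate N n) e}"
  proof (rule Simons_convex_class[where Q = "{f. c \<le> \<mu> f}" and c = "(c + c') / 2" and C = C])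
    fix f g :: "'e \<Rightarrow> real" and s t :: real
    assume f: "continuous_on UNIV f" and g: "continuous_on UNIV g"
      and fg: "f \<in> {f. c \<le> \<mu> f}" "g \<in> {f. c \<le> \<mu> f}" and st: "0 \<le> s" "0 \<le> t" "s + t = 1"
    have "c = s * c + t * c" using st(3) by (simp flip: distrib_right)
    also have "\<dots> \<le> s * \<mu> f + t * \<mu> g" using fg st by (intro add_mono mult_left_mono) auto
    also have "\<dots> = \<mu> (\<lambda>e. s * f e + t * g e)"
      using mean_add[OF \<mu>, of "\<lambda>e. s * f e" "\<lambda>e. t * g e"] mean_cmult[OF \<mu>] f g
      by (simp add: continuous_on_mult_left)
    finally show "(\<lambda>e. s * f e + t * g e) \<in> {f. c \<le> \<mu> f}" by simp
  next
    fix f :: "'e \<Rightarrow> real" assume f: "continuous_on UNIV f" "f \<in> {f. c \<le> \<mu> f}"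
    show "\<exists>e. (c + c') / 2 \<le> f e"
    proof (rule ccontr)
      assume "\<not> ?thesis"
      then have "\<mu> f \<le> (c + c') / 2"
        using mean_mono[OF \<mu> f(1), of "\<lambda>_. (c + c') / 2"] mean_const[OF \<mu>]
        by (simp add: not_le less_imp_le)
      with f(2) c' show False by simp
    qed
  qed (use comp cont bdd big c' enumerate_in_set[OF N] in auto)
  then obtain e where e: "infinite {n. c' < h (enumerate N n) e}" by blast
  have sub: "enumerate N ` {n. c' < h (enumerate N n) e} \<subseteq> {n \<in> N. c' < h n e}"
    using enumerate_in_set[OF N] by auto
  have inj: "inj_on (enumerate N) X" for X
    using inj_enumerate[OF N] by (rule inj_on_subset) simp
  have "infinite {n \<in> N. c' < h n e}"
  proof
    assume "finite {n \<in> N. c' < h n e}"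
    then have "finite (enumerate N ` {n. c' < h (enumerate N n) e})" by (rule finite_subset[OF sub])
    with inj have "finite {n. c' < h (enumerate N n) e}" by (blast dest: finite_imageD)
    with e show False by simp
  qed
  then show ?thesis by blast
qed

text \<open>
  Fatou's lemma is applied to one mean after the other, each time along the infinite set of indices
  left by its predecessor; a diagonal sequence through these sets serves all points at once.
\<close>

lemma successive_thinning:
  fixes u h :: "nat \<Rightarrow> 'e::topological_space \<Rightarrow> real"
  assumes comp: "compact (UNIV :: 'e set)" and \<mu>: "\<And>i. mean (\<mu> i)" and N0: "infinite N0"
    and u: "\<And>n. continuous_on UNIV (u n)" "\<And>n e. 0 \<le> u n e" "\<And>n e. u n e \<le> 1"
    and h: "\<And>i. continuous_on UNIV (h i)" "\<And>i e. 0 \<le> h i e" "\<And>i e. h i e \<le> 1"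
    and c: "\<And>i. 0 < c i" "\<And>i. \<forall>\<^sub>F n in sequentially. c i \<le> \<mu> i (\<lambda>e. u n e * h i e)"
  obtains \<sigma> :: "nat \<Rightarrow> nat" and es
  where "strict_mono \<sigma>" "\<And>j. \<sigma> j \<in> N0" "\<And>i j. i \<le> j \<Longrightarrow> 0 < u (\<sigma> j) (es i)" "\<And>i. 0 < h i (es i)"
proof -
  have step: "\<exists>e N'. infinite N' \<and> N' \<subseteq> N \<and> (\<forall>n\<in>N'. 0 < u n e * h i e)" if N: "infinite N" for N i
  proof -
    obtain n0 where n0: "\<And>n. n \<ge> n0 \<Longrightarrow> c i \<le> \<mu> i (\<lambda>e. u n e * h i e)"
      using c(2)[of i] by (auto simp: eventually_sequentially)
    have "infinite (N \<inter> {n0..})"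
    proof
      assume "finite (N \<inter> {n0..})"
      then have "finite (N \<inter> {n0..} \<union> {..<n0})" by simp
      then have "finite N" by (rule rev_finite_subset) auto
      with N show False by simp
    qed
    then have "\<exists>e. infinite {n \<in> N \<inter> {n0..}. 0 < u n e * h i e}"
      using n0 u h c(1)[of i]
      by (intro mean_Fatou[OF comp \<mu>[of i], where C = 1 and c = "c i"])
        (auto intro!: continuous_on_mult simp: abs_mult mult_le_one)
    then obtain e where "infinite {n \<in> N \<inter> {n0..}. 0 < u n e * h i e}" by blast
    then show ?thesis by (intro exI[of _ e] exI[of _ "{n \<in> N \<inter> {n0..}. 0 < u n e * h i e}"]) auto
  qed
  define P where "P i r \<longleftrightarrow> infinite (snd r) \<and> snd r \<subseteq> N0 \<and> (\<forall>n\<in>snd r. 0 < u n (fst r) * h i (fst r))"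
    for i and r :: "'e \<times> nat set"
  have "\<exists>s. \<forall>i. P i (s i) \<and> snd (s (Suc i)) \<subseteq> snd (s i)"
  proof (rule dependent_nat_choice)
    obtain e N where "infinite N" "N \<subseteq> N0" "\<forall>n\<in>N. 0 < u n e * h 0 e"
      using step[OF N0, of 0] by (elim exE conjE)
    then have "P 0 (e, N)" by (simp add: P_def)
    then show "\<exists>r. P 0 r" by (rule exI)
    fix r i assume r: "P i r"
    then have "infinite (snd r)" by (simp add: P_def)
    from step[OF this, of "Suc i"] obtain e N
      where N: "infinite N" "N \<subseteq> snd r" "\<forall>n\<in>N. 0 < u n e * h (Suc i) e"
      by (elim exE conjE)
    moreover have "N \<subseteq> N0" using N(2) r by (auto simp: P_def)
    ultimately have "P (Suc i) (e, N) \<and> snd (e, N) \<subseteq> snd r" by (simp add: P_def)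
    then show "\<exists>r'. P (Suc i) r' \<and> snd r' \<subseteq> snd r" by (rule exI)
  qed
  then obtain s where s: "\<And>i. P i (s i)" "\<And>i. snd (s (Suc i)) \<subseteq> snd (s i)" by blast
  have anti: "snd (s j) \<subseteq> snd (s i)" if "i \<le> j" for i j
    using that by (rule lift_Suc_antimono_le[of "\<lambda>i. snd (s i)", OF s(2)])
  have "\<exists>\<sigma>. \<forall>j. \<sigma> j \<in> snd (s j) \<and> \<sigma> j < \<sigma> (Suc j)"
  proof (rule dependent_nat_choice)
    show "\<exists>n. n \<in> snd (s 0)" using s(1)[of 0] infinite_imp_nonempty[of "snd (s 0)"] by (auto simp: P_def)
    fix n j :: nat
    show "\<exists>n'. n' \<in> snd (s (Suc j)) \<and> n < n'"
      using s(1)[of "Suc j"] by (auto simp: P_def infinite_nat_iff_unbounded)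
  qed
  then obtain \<sigma> where \<sigma>: "\<And>j. \<sigma> j \<in> snd (s j)" "\<And>j. \<sigma> j < \<sigma> (Suc j)" by blast
  have pos: "0 < u (\<sigma> j) (fst (s i)) * h i (fst (s i))" if "i \<le> j" for i j
    using s(1)[of i] subsetD[OF anti[OF that] \<sigma>(1)[of j]] by (simp add: P_def)
  have pos': "0 < u (\<sigma> j) (fst (s i)) \<and> 0 < h i (fst (s i))" if "i \<le> j" for i j
    using pos[OF that] u(2)[of "\<sigma> j" "fst (s i)"] h(2)[of i "fst (s i)"]
    by (auto simp: zero_less_mult_iff)
  show thesis
  proof (rule that[of \<sigma> "\<lambda>i. fst (s i)"])
    show "strict_mono \<sigma>" using \<sigma>(2) by (simp add: strict_mono_Suc_iff)
    show "\<sigma> j \<in> N0" for j using \<sigma>(1)[of j] s(1)[of j] by (auto simp: P_def)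
    show "0 < u (\<sigma> j) (fst (s i))" if "i \<le> j" for i j using pos'[OF that] by simp
    show "0 < h i (fst (s i))" for i using pos'[OF order.refl] by simp
  qed
qed

section \<open>From means to points\<close>

definition ramp :: "real \<Rightarrow> real" where "ramp w = min 1 (max 0 w)"

text \<open>
  A triangular bump on the interval from \<open>t\<close> to \<open>t + 2 * \<delta>\<close>. Translates by multiples of \<open>\<delta>\<close> telescope
  to a partition of unity, which serves as a continuous substitute for cutting the range of a
  function into short intervals.
\<close>

definition layer :: "real \<Rightarrow> real \<Rightarrow> real \<Rightarrow> real" where
  "layer \<delta> t z = ramp ((z - t) / \<delta>) - ramp ((z - t) / \<delta> - 1)"

lemma continuous_on_layer:
  assumes "continuous_on S f" shows "continuous_on S (\<lambda>e. layer \<delta> t (f e))"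
  unfolding layer_def ramp_def divide_inverse by (intro continuous_intros assms)

lemma layer_nonneg: "0 \<le> layer \<delta> t z"
  by (simp add: layer_def ramp_def)

lemma layer_le_1: "layer \<delta> t z \<le> 1"
  by (simp add: layer_def ramp_def)

lemma layer_pos_imp:
  assumes "0 < layer \<delta> t z" "0 < \<delta>"
  shows "t \<le> z" and "z \<le> t + 2 * \<delta>"
proof -
  have "0 < (z - t) / \<delta>" "(z - t) / \<delta> < 2"
    using assms(1) by (auto simp: layer_def ramp_def min_def max_def split: if_splits)
  then show "t \<le> z" "z \<le> t + 2 * \<delta>" using assms(2) by (auto simp: field_simps)
qed

lemma layer_sum:
  assumes \<delta>: "0 < \<delta>" and z: "t + \<delta> \<le> z" "z \<le> t + real S * \<delta>"
  shows "(\<Sum>s<S. layer \<delta> (t + real s * \<delta>) z) = 1"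
proof -
  have "(\<Sum>s<S. layer \<delta> (t + real s * \<delta>) z)
      = (\<Sum>s<S. ramp ((z - t) / \<delta> - real s) - ramp ((z - t) / \<delta> - real (Suc s)))"
  proof (rule sum.cong[OF refl])
    fix s
    have eq: "(z - (t + real s * \<delta>)) / \<delta> = (z - t) / \<delta> - real s" using \<delta> by (simp add: field_simps)
    have "(z - t) / \<delta> - real s - 1 = (z - t) / \<delta> - real (Suc s)" by simp
    then show "layer \<delta> (t + real s * \<delta>) z
        = ramp ((z - t) / \<delta> - real s) - ramp ((z - t) / \<delta> - real (Suc s))"
      by (simp only: layer_def eq)
  qed
  also have "\<dots> = ramp ((z - t) / \<delta>) - ramp ((z - t) / \<delta> - real S)"
    by (subst sum_lessThan_telescope') simp
  also have "\<dots> = 1"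
  proof -
    have "1 \<le> (z - t) / \<delta>" "(z - t) / \<delta> \<le> real S" using \<delta> z by (auto simp: field_simps)
    then show ?thesis by (simp add: ramp_def)
  qed
  finally show ?thesis .
qed

lemma layer_mult_le:
  assumes "0 < \<delta>" shows "layer \<delta> t z * z \<le> (t + 2 * \<delta>) * layer \<delta> t z"
proof (cases "0 < layer \<delta> t z")
  case True
  then show ?thesis using layer_pos_imp(2)[OF True assms] by simp
next
  case False
  then show ?thesis using layer_nonneg[of \<delta> t z] by simp
qed

text \<open>
  Think of \<open>r s\<close> and \<open>p s k\<close> as the mass of the layer \<open>s\<close> of a far away \<open>x n\<close>, and the integral of
  \<open>x k\<close> over that layer, both taken in the iterated limit. Summed over the layers, the masses
  weighted by the upper ends \<open>T s + 2 * \<delta>\<close> give at least \<open>d\<close>, while the integrals of \<open>x k\<close> give at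
  most \<open>0\<close>. So for each \<open>k\<close> some layer shows the gap \<open>d\<close> on average, up to a few \<open>\<delta>\<close>, and one layer
  does so for infinitely many \<open>k\<close>.
\<close>

lemma layer_of_positive_gap:
  fixes x :: "nat \<Rightarrow> 'e::topological_space \<Rightarrow> real"
  assumes \<mu>: "\<And>m. mean (\<mu> m)"
    and x: "\<And>n. continuous_on UNIV (x n)" "\<And>n e. \<bar>x n e\<bar> \<le> M" and \<delta>: "0 < \<delta>"
    and above: "\<And>m. \<forall>\<^sub>F n in sequentially. d \<le> \<mu> m (x n)"
    and below: "\<And>k. \<forall>\<^sub>F m in sequentially. \<mu> m (x k) \<le> 0"
    and T: "\<And>s. T s = - M - \<delta> + real s * \<delta>" and S: "M \<le> T S"
    and R: "\<And>m s. (\<lambda>n. \<mu> m (\<lambda>e. layer \<delta> (T s) (x n e))) \<longlonglongrightarrow> R m s"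
    and r: "\<And>s. (\<lambda>m. R m s) \<longlonglongrightarrow> r s"
    and P: "\<And>m s k. (\<lambda>n. \<mu> m (\<lambda>e. layer \<delta> (T s) (x n e) * x k e)) \<longlonglongrightarrow> P m s k"
    and p: "\<And>s k. (\<lambda>m. P m s k) \<longlonglongrightarrow> p s k"
  obtains s K c where "infinite K" "0 < c" "\<And>k. k \<in> K \<Longrightarrow> c \<le> (T s + 3 * \<delta> - d) * r s - p s k"
proof -
  define u where "u s n e = layer \<delta> (T s) (x n e)" for s n e
  have ucont: "continuous_on UNIV (u s n)" for s n
    unfolding u_def by (rule continuous_on_layer[OF x(1)])
  have usum: "(\<Sum>s<S. u s n e) = 1" for n e
    unfolding u_def T using x(2)[of n e] S by (intro layer_sum \<delta>) (auto simp: T abs_le_iff)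
  have \<mu>sum: "(\<Sum>s<S. \<mu> m (\<lambda>e. u s n e * f e)) = \<mu> m f" if "continuous_on UNIV f" for m n f
    using mean_sum[OF \<mu>, of "{..<S}" "\<lambda>s e. u s n e * f e" m] that ucont
    by (simp add: continuous_on_mult sum_distrib_right[symmetric] usum)
  have sumR: "(\<Sum>s<S. R m s) = 1" for m
  proof (rule LIMSEQ_unique)
    show "(\<lambda>n. \<Sum>s<S. \<mu> m (u s n)) \<longlonglongrightarrow> (\<Sum>s<S. R m s)"
      unfolding u_def by (intro tendsto_sum R)
    show "(\<lambda>n. \<Sum>s<S. \<mu> m (u s n)) \<longlonglongrightarrow> 1"
      using \<mu>sum[of "\<lambda>_. 1" m] mean_const[OF \<mu>, of m 1] by simp
  qed
  have sumr: "(\<Sum>s<S. r s) = 1"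
  proof (rule LIMSEQ_unique)
    show "(\<lambda>m. \<Sum>s<S. R m s) \<longlonglongrightarrow> (\<Sum>s<S. r s)" by (intro tendsto_sum r)
    show "(\<lambda>m. \<Sum>s<S. R m s) \<longlonglongrightarrow> 1" by (simp add: sumR)
  qed
  have sumP: "(\<Sum>s<S. P m s k) = \<mu> m (x k)" for m k
  proof (rule LIMSEQ_unique)
    show "(\<lambda>n. \<Sum>s<S. \<mu> m (\<lambda>e. u s n e * x k e)) \<longlonglongrightarrow> (\<Sum>s<S. P m s k)"
      unfolding u_def by (intro tendsto_sum P)
    show "(\<lambda>n. \<Sum>s<S. \<mu> m (\<lambda>e. u s n e * x k e)) \<longlonglongrightarrow> \<mu> m (x k)"
      using \<mu>sum[OF x(1)[of k], of m] by simp
  qed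
  have sump: "(\<Sum>s<S. p s k) \<le> 0" for k
  proof (rule tendsto_upperbound)
    show "(\<lambda>m. \<Sum>s<S. P m s k) \<longlonglongrightarrow> (\<Sum>s<S. p s k)" by (intro tendsto_sum p)
    show "\<forall>\<^sub>F m in sequentially. (\<Sum>s<S. P m s k) \<le> 0" using below[of k] by (simp add: sumP)
  qed simp
  have xle: "x n e \<le> (\<Sum>s<S. (T s + 2 * \<delta>) * u s n e)" for n e
  proof -
    have "x n e = (\<Sum>s<S. u s n e * x n e)" by (simp add: sum_distrib_right[symmetric] usum)
    also have "\<dots> \<le> (\<Sum>s<S. (T s + 2 * \<delta>) * u s n e)"
      unfolding u_def by (intro sum_mono layer_mult_le \<delta>)
    finally show ?thesis .
  qed
  have \<mu>x: "\<mu> m (x n) \<le> (\<Sum>s<S. (T s + 2 * \<delta>) * \<mu> m (u s n))" for m n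
  proof -
    have "\<mu> m (x n) \<le> \<mu> m (\<lambda>e. \<Sum>s<S. (T s + 2 * \<delta>) * u s n e)"
      by (intro mean_mono[OF \<mu>] x xle continuous_intros ucont)
    also have "\<dots> = (\<Sum>s<S. \<mu> m (\<lambda>e. (T s + 2 * \<delta>) * u s n e))"
      by (intro mean_sum \<mu>) (auto intro!: continuous_intros ucont)
    also have "\<dots> = (\<Sum>s<S. (T s + 2 * \<delta>) * \<mu> m (u s n))"
      by (intro sum.cong refl mean_cmult \<mu> ucont)
    finally show ?thesis .
  qed
  have "d \<le> (\<Sum>s<S. (T s + 2 * \<delta>) * R m s)" for m
  proof (rule tendsto_lowerbound)
    show "(\<lambda>n. \<Sum>s<S. (T s + 2 * \<delta>) * \<mu> m (u s n)) \<longlonglongrightarrow> (\<Sum>s<S. (T s + 2 * \<delta>) * R m s)"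
      unfolding u_def by (intro tendsto_intros R)
    show "\<forall>\<^sub>F n in sequentially. d \<le> (\<Sum>s<S. (T s + 2 * \<delta>) * \<mu> m (u s n))"
      using above[of m] by eventually_elim (use \<mu>x in \<open>blast intro: order.trans\<close>)
  qed simp
  then have sumTr: "d \<le> (\<Sum>s<S. (T s + 2 * \<delta>) * r s)"
    by (intro LIMSEQ_le_const[OF tendsto_sum[OF tendsto_mult[OF tendsto_const r]]]) auto
  \<comment> \<open>One further \<open>\<delta>\<close> is given away to make the sum over the layers strictly positive.\<close>
  define G where "G k s = (T s + 3 * \<delta> - d) * r s - p s k" for k s
  have G\<delta>: "\<delta> \<le> (\<Sum>s<S. G k s)" for k
  proof -
    have "(\<Sum>s<S. G k s) = (\<Sum>s<S. (T s + 2 * \<delta>) * r s) + (\<delta> - d) * (\<Sum>s<S. r s) - (\<Sum>s<S. p s k)"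
      unfolding sum_distrib_left sum.distrib[symmetric] sum_subtractf[symmetric]
      by (rule sum.cong) (auto simp: G_def algebra_simps)
    with sumTr sump[of k] sumr show ?thesis by simp
  qed
  have S0: "0 < S" using sumr by (cases S) auto
  have "\<exists>s<S. \<delta> / real S \<le> G k s" for k
  proof (rule ccontr)
    assume "\<not> ?thesis"
    then have "(\<Sum>s<S. G k s) < (\<Sum>s<S. \<delta> / real S)"
      using S0 by (intro sum_strict_mono) (auto simp: not_le)
    with G\<delta>[of k] S0 show False by simp
  qed
  then obtain \<sigma> where \<sigma>: "\<And>k. \<sigma> k < S" "\<And>k. \<delta> / real S \<le> G k (\<sigma> k)" by metis
  have "finite (range \<sigma>)" by (rule finite_subset[of _ "{..<S}"]) (use \<sigma>(1) in auto)
  then obtain k0 where k0: "infinite {k. \<sigma> k = \<sigma> k0}"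
    using pigeonhole_infinite[of "UNIV :: nat set" \<sigma>] by auto
  show thesis
  proof (rule that[OF k0, of "\<delta> / real S" "\<sigma> k0"])
    show "0 < \<delta> / real S" using \<delta> S0 by simp
    show "\<delta> / real S \<le> (T (\<sigma> k0) + 3 * \<delta> - d) * r (\<sigma> k0) - p (\<sigma> k0) k" if "k \<in> {k. \<sigma> k = \<sigma> k0}" for k
      using \<sigma>(2)[of k] that by (simp add: G_def)
  qed
qed

text \<open>
  Here \<open>u n\<close> is a weight, and \<open>f \<mapsto> lim\<^sub>m lim\<^sub>n \<mu> m (u n * f)\<close> is a positive functional under which
  \<open>\<beta> - x k\<close> has integral at least \<open>c > 0\<close> for \<open>k \<in> K\<close>. A Fatou argument yields a point where \<open>x k \<le> \<beta>\<close>
  infinitely often. To keep that point out of the countably many sets \<open>{h q > 0}\<close> of vanishing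
  mass, a penalty is subtracted which is built from finitely many null functions at a time: it
  does not change the integrals, but in the limit it cancels \<open>\<beta> - x k\<close> on each of these sets.
\<close>

lemma point_in_support:
  fixes x u :: "nat \<Rightarrow> 'e::topological_space \<Rightarrow> real" and h :: "'q::countable \<Rightarrow> 'e \<Rightarrow> real"
  assumes comp: "compact (UNIV :: 'e set)" and \<mu>: "\<And>m. mean (\<mu> m)"
    and x: "\<And>n. continuous_on UNIV (x n)" "\<And>n e. \<bar>x n e\<bar> \<le> M"
    and u: "\<And>n. continuous_on UNIV (u n)" "\<And>n e. 0 \<le> u n e" "\<And>n e. u n e \<le> 1"
    and h: "\<And>q. continuous_on UNIV (h q)" "\<And>q e. 0 \<le> h q e"
    and R: "\<And>m. (\<lambda>n. \<mu> m (u n)) \<longlonglongrightarrow> R m" and r: "R \<longlonglongrightarrow> r"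
    and H: "\<And>m q. (\<lambda>n. \<mu> m (\<lambda>e. u n e * h q e)) \<longlonglongrightarrow> H m q"
    and \<eta>: "\<And>q. (\<lambda>m. H m q) \<longlonglongrightarrow> \<eta> q"
    and P: "\<And>m k. (\<lambda>n. \<mu> m (\<lambda>e. u n e * x k e)) \<longlonglongrightarrow> P m k"
    and p: "\<And>k. (\<lambda>m. P m k) \<longlonglongrightarrow> p k"
    and K: "infinite K" and c: "0 < c" "\<And>k. k \<in> K \<Longrightarrow> c \<le> \<beta> * r - p k"
  obtains e where "infinite {k. x k e \<le> \<beta>}" "\<And>q. 0 < h q e \<Longrightarrow> 0 < \<eta> q"
proof -
  \<comment> \<open>The null functions, enumerated by the natural numbers; \<open>0\<close> fills the other places.\<close>
  define z where "z l e = (if \<eta> (from_nat l) = 0 then h (from_nat l) e else 0)" for l e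
  have z: "continuous_on UNIV (z l)" "0 \<le> z l e" for l e
    using h by (cases "\<eta> (from_nat l) = 0"; simp add: z_def[abs_def])+
  define C where "C = \<bar>\<beta>\<bar> + M"
  have C: "\<bar>\<beta> - x k e\<bar> \<le> C" for k e using x(2)[of k e] by (simp add: C_def)
  have C0: "0 \<le> C" using C[of 0] abs_ge_zero order.trans by blast
  define pen where "pen j e = min 1 (real j * (\<Sum>l<j. z l e))" for j e
  have pencont: "continuous_on UNIV (pen j)" for j
    unfolding pen_def by (intro continuous_intros z)
  have pen01: "0 \<le> pen j e" "pen j e \<le> 1" for j e
    using z(2) by (auto simp: pen_def intro!: mult_nonneg_nonneg sum_nonneg)
  define g where "g j e = \<beta> - x (enumerate K j) e - C * pen j e" for j e
  have gcont: "continuous_on UNIV (g j)" for j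
    unfolding g_def by (intro continuous_intros x pencont)
  \<comment> \<open>A formulation of \<open>lim lim \<mu> m (u n * f) \<ge> c\<close> that does not presuppose the limits for \<open>f\<close>,
    which exist only for the functions listed in the hypotheses.\<close>
  define Q where "Q = {f. \<forall>\<theta>>0. \<forall>\<^sub>F m in sequentially. \<forall>\<^sub>F n in sequentially.
      c - \<theta> \<le> \<mu> m (\<lambda>e. u n e * f e)}"
  have zlim: "\<exists>Z. (\<forall>m. (\<lambda>n. \<mu> m (\<lambda>e. u n e * z l e)) \<longlonglongrightarrow> Z m) \<and> Z \<longlonglongrightarrow> 0" for l
  proof (cases "\<eta> (from_nat l) = 0")
    case True
    then show ?thesis using H[of _ "from_nat l"] \<eta>[of "from_nat l"]
      by (intro exI[of _ "\<lambda>m. H m (from_nat l)"]) (simp add: z_def)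
  next
    case False
    then show ?thesis by (intro exI[of _ "\<lambda>m. 0"]) (simp add: z_def mean_const[OF \<mu>])
  qed
  then obtain Z where Z: "\<And>l m. (\<lambda>n. \<mu> m (\<lambda>e. u n e * z l e)) \<longlonglongrightarrow> Z l m" "\<And>l. Z l \<longlonglongrightarrow> 0"
    by metis
  have gQ: "g j \<in> Q" for j
  proof -
    define k where "k = enumerate K j"
    have k: "c \<le> \<beta> * r - p k" using c(2) enumerate_in_set[OF K] by (simp add: k_def)
    define w where "w m n = \<beta> * \<mu> m (u n) - \<mu> m (\<lambda>e. u n e * x k e)
        - C * real j * (\<Sum>l<j. \<mu> m (\<lambda>e. u n e * z l e))" for m n
    define W where "W m = \<beta> * R m - P m k - C * real j * (\<Sum>l<j. Z l m)" for m
    have wW: "w m \<longlonglongrightarrow> W m" for m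
      unfolding w_def W_def by (intro tendsto_intros R P Z)
    have "W \<longlonglongrightarrow> \<beta> * r - p k - C * real j * (\<Sum>l<j. 0)"
      unfolding W_def by (intro tendsto_intros r p Z)
    then have W: "W \<longlonglongrightarrow> \<beta> * r - p k" by simp
    have le: "w m n \<le> \<mu> m (\<lambda>e. u n e * g j e)" for m n
    proof -
      let ?f = "\<lambda>e. \<beta> * u n e - u n e * x k e - C * real j * (\<Sum>l<j. u n e * z l e)"
      have "w m n = \<mu> m ?f"
        by (simp add: w_def mean_diff[OF \<mu>] mean_cmult[OF \<mu>] mean_sum[OF \<mu>]
            continuous_on_mult continuous_on_mult_left continuous_on_sum continuous_on_diff u x z)
      also have "\<dots> \<le> \<mu> m (\<lambda>e. u n e * g j e)"
      proof (rule mean_mono[OF \<mu>])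
        show "continuous_on UNIV ?f" by (intro continuous_intros u x z)
        show "continuous_on UNIV (\<lambda>e. u n e * g j e)" by (intro continuous_intros u gcont)
        fix e
        have "pen j e \<le> real j * (\<Sum>l<j. z l e)" by (simp add: pen_def)
        then have "C * u n e * pen j e \<le> C * u n e * (real j * (\<Sum>l<j. z l e))"
          using C0 u(2) by (intro mult_left_mono) auto
        then show "?f e \<le> u n e * g j e"
          by (simp add: g_def k_def[symmetric] algebra_simps sum_distrib_left)
      qed
      finally show ?thesis .
    qed
    show ?thesis
      unfolding Q_def
    proof (intro CollectI allI impI)
      fix \<theta> :: real assume \<theta>: "0 < \<theta>"
      have "\<forall>\<^sub>F m in sequentially. c - \<theta> < W m"
        using k \<theta> by (intro order_tendstoD(1)[OF W]) simp
      then show "\<forall>\<^sub>F m in sequentially. \<forall>\<^sub>F n in sequentially. c - \<theta> \<le> \<mu> m (\<lambda>e. u n e * g j e)"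
      proof eventually_elim
        case (elim m)
        from order_tendstoD(1)[OF wW elim] show ?case
          by eventually_elim (use le in \<open>auto intro: order.trans less_imp_le\<close>)
      qed
    qed
  qed
  have "\<exists>e. infinite {j. c / 4 < g j e}"
  proof (rule Simons_convex_class[OF comp gcont _ gQ, where C = "2 * C" and c = "c / 2"])
    show "\<bar>g j e\<bar> \<le> 2 * C" for j e
    proof -
      have "0 \<le> C * pen j e" using C0 pen01 by simp
      moreover have "C * pen j e \<le> C * 1" using C0 pen01(2) by (rule mult_left_mono[rotated])
      ultimately have "\<bar>C * pen j e\<bar> \<le> C" by simp
      with C[of "enumerate K j" e] show ?thesis by (simp add: g_def)
    qed
    show "c / 4 < c / 2" using c(1) by simp
    fix f assume f: "continuous_on UNIV f" "f \<in> Q"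
    show "\<exists>e. c / 2 \<le> f e"
    proof (rule ccontr)
      assume "\<not> ?thesis"
      then have small: "f e \<le> c / 2" for e by (simp add: not_le less_imp_le)
      have "u n e * f e \<le> c / 2" for n e
      proof -
        have "u n e * f e \<le> u n e * (c / 2)" using small u(2) by (rule mult_left_mono)
        also have "\<dots> \<le> 1 * (c / 2)" using u(3) c(1) by (intro mult_right_mono) auto
        finally show ?thesis by simp
      qed
      then have le: "\<mu> m (\<lambda>e. u n e * f e) \<le> c / 2" for m n
        using mean_mono[OF \<mu>, of "\<lambda>e. u n e * f e" "\<lambda>_. c / 2" m] mean_const[OF \<mu>, of m] f u
        by (simp add: continuous_on_mult)
      have "\<forall>\<^sub>F m in sequentially. \<forall>\<^sub>F n in sequentially. c - c / 4 \<le> \<mu> m (\<lambda>e. u n e * f e)"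
        using f(2) c(1) unfolding Q_def by (elim CollectE allE[of _ "c / 4"]) simp
      then have "\<exists>m n. c - c / 4 \<le> \<mu> m (\<lambda>e. u n e * f e)"
        unfolding eventually_sequentially by (meson order.refl)
      then obtain m n where "c - c / 4 \<le> \<mu> m (\<lambda>e. u n e * f e)" by blast
      with le[of m n] c(1) show False by simp
    qed
  next
    fix f g :: "'e \<Rightarrow> real" and s t :: real
    assume fg: "continuous_on UNIV f" "continuous_on UNIV g" "f \<in> Q" "g \<in> Q"
      and st: "0 \<le> s" "0 \<le> t" "s + t = 1"
    show "(\<lambda>e. s * f e + t * g e) \<in> Q"
      unfolding Q_def
    proof (intro CollectI allI impI)
      fix \<theta> :: real assume \<theta>: "0 < \<theta>"
      have "\<forall>\<^sub>F m in sequentially. \<forall>\<^sub>F n in sequentially. c - \<theta> \<le> \<mu> m (\<lambda>e. u n e * f e)"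
        "\<forall>\<^sub>F m in sequentially. \<forall>\<^sub>F n in sequentially. c - \<theta> \<le> \<mu> m (\<lambda>e. u n e * g e)"
        using fg \<theta> by (auto simp: Q_def)
      then show "\<forall>\<^sub>F m in sequentially. \<forall>\<^sub>F n in sequentially.
          c - \<theta> \<le> \<mu> m (\<lambda>e. u n e * (s * f e + t * g e))"
      proof eventually_elim
        case (elim m)
        then show ?case
        proof eventually_elim
          case (elim n)
          have "c - \<theta> = s * (c - \<theta>) + t * (c - \<theta>)" using st(3) by (simp flip: distrib_right)
          also have "\<dots> \<le> s * \<mu> m (\<lambda>e. u n e * f e) + t * \<mu> m (\<lambda>e. u n e * g e)"
            using elim st by (intro add_mono mult_left_mono) auto
          also have "\<dots> = \<mu> m (\<lambda>e. s * (u n e * f e) + t * (u n e * g e))"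
            by (simp add: mean_add[OF \<mu>] mean_cmult[OF \<mu>] continuous_on_mult continuous_on_mult_left u fg)
          also have "(\<lambda>e. s * (u n e * f e) + t * (u n e * g e)) = (\<lambda>e. u n e * (s * f e + t * g e))"
            by (auto simp: algebra_simps)
          finally show ?case .
        qed
      qed
    qed
  qed
  then obtain e where e: "infinite {j. c / 4 < g j e}" by blast
  have \<eta>0: "0 \<le> \<eta> q" for q
  proof (rule LIMSEQ_le_const[OF \<eta>])
    have "0 \<le> \<mu> m (\<lambda>e. u n e * h q e)" for m n
      using mean_mono[OF \<mu>, of "\<lambda>_. 0" "\<lambda>e. u n e * h q e" m] mean_const[OF \<mu>, of m 0] u h
      by (simp add: continuous_on_mult)
    then have "0 \<le> H m q" for m by (intro LIMSEQ_le_const[OF H]) blast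
    then show "\<exists>N. \<forall>m\<ge>N. 0 \<le> H m q" by blast
  qed
  show thesis
  proof (rule that)
    show "infinite {k. x k e \<le> \<beta>}"
    proof
      assume fin: "finite {k. x k e \<le> \<beta>}"
      have "enumerate K ` {j. c / 4 < g j e} \<subseteq> {k. x k e \<le> \<beta>}"
      proof (intro subsetI CollectI)
        fix k assume "k \<in> enumerate K ` {j. c / 4 < g j e}"
        then obtain j where j: "k = enumerate K j" "c / 4 < g j e" by blast
        have "0 \<le> C * pen j e" using C0 pen01 by simp
        with j c(1) show "x k e \<le> \<beta>" by (simp add: g_def)
      qed
      with fin have "finite (enumerate K ` {j. c / 4 < g j e})" by (blast intro: finite_subset)
      moreover have "inj_on (enumerate K) {j. c / 4 < g j e}"
        using inj_enumerate[OF K] by (rule inj_on_subset) simp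
      ultimately show False using e by (blast dest: finite_imageD)
    qed
    fix q assume q: "0 < h q e"
    show "0 < \<eta> q"
    proof (rule ccontr)
      assume "\<not> ?thesis"
      with \<eta>0[of q] have "\<eta> q = 0" by simp
      then have zq: "z (to_nat q) e = h q e" by (simp add: z_def)
      obtain j0 :: nat where j0: "1 / h q e < real j0" using reals_Archimedean2 by blast
      have "j \<le> max j0 (to_nat q)" if j: "c / 4 < g j e" for j
      proof (rule ccontr)
        assume jbig: "\<not> ?thesis"
        have "1 \<le> real j0 * h q e" using j0 q by (simp add: field_simps)
        also have "\<dots> \<le> real j * (\<Sum>l<j. z l e)"
        proof (rule mult_mono)
          show "h q e \<le> (\<Sum>l<j. z l e)"
            unfolding zq[symmetric] using jbig z(2) by (intro member_le_sum) auto
        qed (use jbig q in auto)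
        finally have "pen j e = 1" by (simp add: pen_def)
        with C[of "enumerate K j" e] j c(1) show False by (simp add: g_def)
      qed
      then have "{j. c / 4 < g j e} \<subseteq> {..max j0 (to_nat q)}" by blast
      with e show False using finite_subset by blast
    qed
  qed
qed

text \<open>
  Sequential compactness of a countable product of intervals replaces the usual diagonal argument.
\<close>

lemma bounded_family_convergent_subsequence:
  fixes f :: "nat \<Rightarrow> 'i::countable \<Rightarrow> real"
  assumes "\<And>n i. \<bar>f n i\<bar> \<le> C"
  obtains \<rho> l where "strict_mono \<rho>" "\<And>i. (\<lambda>n. f (\<rho> n) i) \<longlonglongrightarrow> l i"
proof -
  define K :: "('i \<Rightarrow> real) set" where "K = PiE UNIV (\<lambda>_. {-C..C})"
  have "compactin (product_topology (\<lambda>_. euclidean) UNIV) K"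
    unfolding K_def compactin_PiE by (simp add: compactin_euclidean_iff)
  then have "seq_compact K"
    by (intro compact_imp_seq_compact) (simp add: euclidean_product_topology compactin_euclidean_iff)
  moreover have "f n \<in> K" for n using assms[of n] by (auto simp: K_def abs_le_iff minus_le_iff)
  ultimately obtain l \<rho> where l: "strict_mono \<rho>" "(f \<circ> \<rho>) \<longlonglongrightarrow> l"
    by (meson seq_compactE)
  have "((\<lambda>g. g i) \<circ> (f \<circ> \<rho>)) \<longlonglongrightarrow> l i" for i
  proof (rule continuous_imp_tendsto[OF _ l(2)])
    show "isCont (\<lambda>g. g i) l"
      using continuous_on_eq_continuous_at[THEN iffD1, OF open_UNIV continuous_on_product_coordinates[of i]]
      by blast
  qed
  with l(1) show thesis by (intro that[of \<rho> l]) (auto simp: comp_def)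
qed

text \<open>
  The list \<open>q\<close> of length \<open>i\<close> encodes a centre with coordinates \<open>q ! k / i\<close>, and the bump is positive
  where \<open>\<bar>x k - q ! k / i\<bar> < 1 / i\<close> for all \<open>k < i\<close>. Integer lists keep the family countable, as is
  needed to pass to subsequences along which all limits exist.
\<close>

definition bump :: "(nat \<Rightarrow> 'e \<Rightarrow> real) \<Rightarrow> int list \<Rightarrow> 'e \<Rightarrow> real" where
  "bump x q e = (\<Prod>k<length q. max 0 (1 - \<bar>real (length q) * x k e - real_of_int (q ! k)\<bar>))"

lemma continuous_on_bump:
  assumes "\<And>k. continuous_on S (x k)" shows "continuous_on S (bump x q)"
  unfolding bump_def[abs_def] by (intro continuous_intros assms)

lemma bump_nonneg: "0 \<le> bump x q e"
  unfolding bump_def by (intro prod_nonneg) auto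

lemma bump_le_1: "bump x q e \<le> 1"
  unfolding bump_def by (intro prod_le_1) auto

lemma bump_Nil: "bump x [] e = 1"
  by (simp add: bump_def)

lemma bump_centre: "0 < bump x (map (\<lambda>k. \<lfloor>real i * x k e\<rfloor>) [0..<i]) e"
  unfolding bump_def
proof (rule prod_pos)
  fix k assume "k \<in> {..<length (map (\<lambda>k. \<lfloor>real i * x k e\<rfloor>) [0..<i])}"
  then show "0 < max 0 (1 - \<bar>real (length (map (\<lambda>k. \<lfloor>real i * x k e\<rfloor>) [0..<i])) * x k e
      - real_of_int (map (\<lambda>k. \<lfloor>real i * x k e\<rfloor>) [0..<i] ! k)\<bar>)"
    by simp linarith
qed

lemma bump_pos_imp:
  assumes "0 < bump x q e" "k < length q"
  shows "\<bar>real (length q) * x k e - real_of_int (q ! k)\<bar> < 1"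
proof (rule ccontr)
  assume "\<not> ?thesis"
  then have "max 0 (1 - \<bar>real (length q) * x k e - real_of_int (q ! k)\<bar>) = 0" by simp
  then have "bump x q e = 0" unfolding bump_def using assms(2) by (intro prod_zero) auto
  with assms(1) show False by simp
qed

text \<open>
  Along suitable subsequences the iterated limits of \<open>\<mu> m (layer (x n) * w)\<close> exist for the countably
  many \<open>w\<close> that matter, the \<open>x k\<close> and the bumps. A layer that shows the gap and a point \<open>e\<close> in
  the support of its limiting mass are fixed. Every bump around \<open>e\<close> then has positive mass together with the layer, so
  thinning yields points \<open>e\<^sub>i\<close> in smaller and smaller bumps around \<open>e\<close> whose values \<open>x n e\<^sub>i\<close> lie in
  that layer.
\<close>

lemma double_limit_extraction:
  fixes x :: "nat \<Rightarrow> 'e::topological_space \<Rightarrow> real"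
  assumes comp: "compact (UNIV :: 'e set)" and \<mu>: "\<And>m. mean (\<mu> m)"
    and x: "\<And>n. continuous_on UNIV (x n)" "\<And>n e. \<bar>x n e\<bar> \<le> M" and \<delta>: "0 < \<delta>"
    and above: "\<And>m n. m \<le> n \<Longrightarrow> d \<le> \<mu> m (x n)"
    and below: "\<And>m n. n < m \<Longrightarrow> \<mu> m (x n) \<le> 0"
  obtains t \<sigma> e es where "strict_mono (\<sigma> :: nat \<Rightarrow> nat)"
    "\<And>i j. i \<le> j \<Longrightarrow> t \<le> x (\<sigma> j) (es i)" "\<And>j. x (\<sigma> j) e \<le> t + 3 * \<delta> - d"
    "\<And>k. (\<lambda>i. x k (es i)) \<longlonglongrightarrow> x k e"
proof -
  define T where "T s = - M - \<delta> + real s * \<delta>" for s :: nat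
  obtain S :: nat where "(2 * M + \<delta>) / \<delta> < real S" using reals_Archimedean2 by blast
  then have S: "M \<le> T S" using \<delta> by (simp add: T_def field_simps)
  \<comment> \<open>The empty list gives the constant bump \<open>1\<close>, hence the masses of the layers themselves.\<close>
  define w where "w v = (case v of Inl k \<Rightarrow> x k | Inr q \<Rightarrow> bump x q)" for v :: "nat + int list"
  have wcont: "continuous_on UNIV (w v)" for v
    by (cases v) (auto simp: w_def intro: x continuous_on_bump)
  have wbd: "\<bar>w v e\<bar> \<le> max M 1" for v e
    using x(2) by (cases v) (auto simp: w_def le_max_iff_disj abs_of_nonneg[OF bump_nonneg] bump_le_1)
  define a where "a s n e = layer \<delta> (T s) (x n e)" for s n e
  have acont: "continuous_on UNIV (a s n)" for s n
    unfolding a_def by (rule continuous_on_layer[OF x(1)])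
  have a01: "0 \<le> a s n e" "a s n e \<le> 1" for s n e
    by (simp_all add: a_def layer_nonneg layer_le_1)
  define f where "f n i = (case i of (m, s, v) \<Rightarrow> \<mu> m (\<lambda>e. a s n e * w v e))"
    for n and i :: "nat \<times> nat \<times> (nat + int list)"
  have aw: "\<bar>\<mu> m (\<lambda>e. a s n e * w v e)\<bar> \<le> max M 1" for m s n v
  proof (rule mean_abs_le[OF \<mu>])
    show "continuous_on UNIV (\<lambda>e. a s n e * w v e)" by (intro continuous_intros acont wcont)
    fix e
    have "\<bar>a s n e * w v e\<bar> \<le> 1 * max M 1"
      unfolding abs_mult using a01 wbd by (intro mult_mono) auto
    then show "\<bar>a s n e * w v e\<bar> \<le> max M 1" by simp
  qed
  have f_bd: "\<bar>f n i\<bar> \<le> max M 1" for n i by (cases i) (simp add: f_def aw)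
  obtain \<rho> l where \<rho>: "strict_mono \<rho>" and l: "\<And>i. (\<lambda>n. f (\<rho> n) i) \<longlonglongrightarrow> l i"
    by (rule bounded_family_convergent_subsequence[of f, OF f_bd]) blast
  have l': "(\<lambda>n. \<mu> m (\<lambda>e. a s (\<rho> n) e * w v e)) \<longlonglongrightarrow> l (m, s, v)" for m s v
    using l[of "(m, s, v)"] by (simp add: f_def)
  have l_bd: "\<bar>l (m, i)\<bar> \<le> max M 1" for m i
  proof (cases i)
    case (Pair s v)
    show ?thesis
      unfolding Pair by (rule LIMSEQ_le_const2[OF tendsto_rabs[OF l']]) (use aw in blast)
  qed
  obtain \<tau> r where \<tau>: "strict_mono \<tau>" and r: "\<And>i. (\<lambda>m. l (\<tau> m, i)) \<longlonglongrightarrow> r i"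
    by (rule bounded_family_convergent_subsequence[of "\<lambda>m i. l (m, i)", OF l_bd]) blast
  have above': "\<forall>\<^sub>F n in sequentially. d \<le> \<mu> (\<tau> m) (x (\<rho> n))" for m
  proof -
    have "\<forall>\<^sub>F n in sequentially. \<tau> m \<le> n" by (rule eventually_ge_at_top)
    then show ?thesis
    proof eventually_elim
      case (elim n)
      then show ?case using seq_suble[OF \<rho>, of n] by (intro above) simp
    qed
  qed
  have below': "\<forall>\<^sub>F m in sequentially. \<mu> (\<tau> m) (x k) \<le> 0" for k
  proof -
    have "\<forall>\<^sub>F m in sequentially. k < m" by (rule eventually_gt_at_top)
    then show ?thesis
    proof eventually_elim
      case (elim m)
      then show ?case using seq_suble[OF \<tau>, of m] by (intro below) simp
    qed
  qed
  have lim1: "(\<lambda>n. \<mu> (\<tau> m) (a s (\<rho> n))) \<longlonglongrightarrow> l (\<tau> m, s, Inr [])" for m s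
    using l'[of "\<tau> m" s "Inr []"] by (simp add: w_def bump_Nil)
  have limx: "(\<lambda>n. \<mu> (\<tau> m) (\<lambda>e. a s (\<rho> n) e * x (\<rho> k) e)) \<longlonglongrightarrow> l (\<tau> m, s, Inl (\<rho> k))" for m s k
    using l'[of "\<tau> m" s "Inl (\<rho> k)"] by (simp add: w_def)
  have limb: "(\<lambda>n. \<mu> (\<tau> m) (\<lambda>e. a s (\<rho> n) e * bump x q e)) \<longlonglongrightarrow> l (\<tau> m, s, Inr q)" for m s q
    using l'[of "\<tau> m" s "Inr q"] by (simp add: w_def)
  obtain s K c where K: "infinite K" "0 < c"
    "\<And>k. k \<in> K \<Longrightarrow> c \<le> (T s + 3 * \<delta> - d) * r (s, Inr []) - r (s, Inl (\<rho> k))"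
    by (rule layer_of_positive_gap[of "\<lambda>m. \<mu> (\<tau> m)" "\<lambda>n. x (\<rho> n)" M \<delta> d T S
          "\<lambda>m s. l (\<tau> m, s, Inr [])" "\<lambda>s. r (s, Inr [])"
          "\<lambda>m s k. l (\<tau> m, s, Inl (\<rho> k))" "\<lambda>s k. r (s, Inl (\<rho> k))",
          OF \<mu> x \<delta> above' below' T_def S lim1[unfolded a_def] r limx[unfolded a_def] r]) blast
  obtain e where e: "infinite {k. x (\<rho> k) e \<le> T s + 3 * \<delta> - d}"
    "\<And>q. 0 < bump x q e \<Longrightarrow> 0 < r (s, Inr q)"
    by (rule point_in_support[of "\<lambda>m. \<mu> (\<tau> m)" "\<lambda>n. x (\<rho> n)" M "\<lambda>n. a s (\<rho> n)" "bump x"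
          "\<lambda>m. l (\<tau> m, s, Inr [])" "r (s, Inr [])" "\<lambda>m q. l (\<tau> m, s, Inr q)" "\<lambda>q. r (s, Inr q)"
          "\<lambda>m k. l (\<tau> m, s, Inl (\<rho> k))" "\<lambda>k. r (s, Inl (\<rho> k))" K c "T s + 3 * \<delta> - d",
          OF comp \<mu> x acont a01 continuous_on_bump bump_nonneg lim1 r limb r limx r K(1,2)])
      (use x K(3) in auto)
  \<comment> \<open>Bumps of increasing fineness whose encoded centre is next to the values at \<open>e\<close>.\<close>
  define q where "q i = map (\<lambda>k. \<lfloor>real i * x k e\<rfloor>) [0..<i]" for i
  have "\<exists>m. 0 < l (\<tau> m, s, Inr (q i))" for i
  proof -
    have "0 < r (s, Inr (q i))" unfolding q_def by (intro e(2) bump_centre)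
    from order_tendstoD(1)[OF r this] show ?thesis by (auto simp: eventually_sequentially)
  qed
  then obtain m where m: "\<And>i. 0 < l (\<tau> (m i), s, Inr (q i))" by metis
  have mass: "\<forall>\<^sub>F n in sequentially. l (\<tau> (m i), s, Inr (q i)) / 2
      \<le> \<mu> (\<tau> (m i)) (\<lambda>e. a s (\<rho> n) e * bump x (q i) e)" for i
  proof -
    have "l (\<tau> (m i), s, Inr (q i)) / 2 < l (\<tau> (m i), s, Inr (q i))" using m[of i] by simp
    from order_tendstoD(1)[OF limb this] show ?thesis by eventually_elim simp
  qed
  obtain \<sigma> es where \<sigma>: "strict_mono (\<sigma> :: nat \<Rightarrow> nat)" "\<And>j. \<sigma> j \<in> {k. x (\<rho> k) e \<le> T s + 3 * \<delta> - d}"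
    "\<And>i j. i \<le> j \<Longrightarrow> 0 < a s (\<rho> (\<sigma> j)) (es i)" "\<And>i. 0 < bump x (q i) (es i)"
    by (rule successive_thinning[of "\<lambda>i. \<mu> (\<tau> (m i))" "{k. x (\<rho> k) e \<le> T s + 3 * \<delta> - d}"
          "\<lambda>n. a s (\<rho> n)" "\<lambda>i. bump x (q i)" "\<lambda>i. l (\<tau> (m i), s, Inr (q i)) / 2",
          OF comp \<mu> e(1) acont a01 continuous_on_bump bump_nonneg bump_le_1 _ mass])
      (use x m in auto)
  show thesis
  proof (rule that[of "\<rho> \<circ> \<sigma>" "T s" es e])
    show "strict_mono (\<rho> \<circ> \<sigma>)" using \<rho> \<sigma>(1) by (rule strict_mono_o)
    show "T s \<le> x ((\<rho> \<circ> \<sigma>) j) (es i)" if "i \<le> j" for i j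
      using layer_pos_imp(1)[OF \<sigma>(3)[OF that, unfolded a_def] \<delta>] by simp
    show "x ((\<rho> \<circ> \<sigma>) j) e \<le> T s + 3 * \<delta> - d" for j using \<sigma>(2)[of j] by simp
    fix k
    show "(\<lambda>i. x k (es i)) \<longlonglongrightarrow> x k e"
    proof (rule LIM_zero_cancel, rule Lim_null_comparison)
      show "(\<lambda>i. 2 / real i) \<longlonglongrightarrow> 0" by (rule lim_const_over_n)
      have "\<forall>\<^sub>F i in sequentially. k < i" by (rule eventually_gt_at_top)
      then show "\<forall>\<^sub>F i in sequentially. norm (x k (es i) - x k e) \<le> 2 / real i"
      proof eventually_elim
        case (elim i)
        have "\<bar>real i * x k (es i) - real_of_int (q i ! k)\<bar> < 1"
          using bump_pos_imp[OF \<sigma>(4)[of i], of k] elim by (simp add: q_def)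
        moreover have "\<bar>real i * x k e - real_of_int (q i ! k)\<bar> < 1"
          using bump_pos_imp[OF bump_centre[of x i e], of k] elim by (simp add: q_def)
        ultimately have "\<bar>real i * x k (es i) - real i * x k e\<bar> \<le> 2" by linarith
        then have "real i * \<bar>x k (es i) - x k e\<bar> \<le> 2"
          by (simp add: abs_mult flip: right_diff_distrib)
        with elim show ?case by (simp add: field_simps)
      qed
    qed
  qed
qed

section \<open>A criterion for compact norming sets\<close>

lemma continuous_map_sigma_topology:
  assumes "b \<in> B"
  shows "continuous_map (sigma_topology B) euclidean (blinfun_apply b)"
proof -
  have "continuous_map (sigma_topology B) euclidean
      ((\<lambda>h. h b) \<circ> (\<lambda>x. \<lambda>b\<in>B. blinfun_apply b x))"
    unfolding sigma_topology_def
    by (intro continuous_map_pullback continuous_map_product_projection assms)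
  then show ?thesis using assms by (simp add: comp_def)
qed

lemma sigma_closure_convex_hull_subset:
  assumes "b \<in> B" "closed C" "convex C" "\<And>z. z \<in> X \<Longrightarrow> blinfun_apply b z \<in> C"
    and "c \<in> sigma_topology B closure_of (convex hull X)"
  shows "blinfun_apply b c \<in> C"
proof -
  have "closedin (sigma_topology B) {z \<in> topspace (sigma_topology B). blinfun_apply b z \<in> C}"
    using assms(2) by (intro closedin_continuous_map_preimage[OF continuous_map_sigma_topology[OF assms(1)]]) simp
  moreover have "topspace (sigma_topology B) = UNIV"
    by (auto simp: sigma_topology_def topspace_pullback_topology)
  ultimately have cl: "closedin (sigma_topology B) {z. blinfun_apply b z \<in> C}" by simp
  have "convex (blinfun_apply b -` C)"
    using assms(3) by (intro convex_linear_vimage bounded_linear.linear[OF blinfun.bounded_linear_right])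
  then have "convex hull X \<subseteq> {z. blinfun_apply b z \<in> C}"
    using assms(4) by (intro hull_minimal) (auto simp: vimage_def)
  from closure_of_minimal[OF this cl] assms(5) show ?thesis by auto
qed

text \<open>
  The functional \<open>b\<close> has to agree with the evaluation at \<open>e\<close> only on the sequence and on \<open>y\<close>. Half-lines
  bounding \<open>b\<close> on the sequence bound it on the \<open>\<sigma>\<^sub>B\<close>-closed convex hull, and the perturbation
  \<open>\<epsilon> u\<close> changes the value by at most \<open>\<epsilon>\<close>.
\<close>

lemma asymptotic_bounds:
  fixes x :: "nat \<Rightarrow> 'x::real_normed_vector" and T :: "'x \<Rightarrow> 'e \<Rightarrow> real"
  assumes B: "B \<subseteq> sphere 0 1" and \<epsilon>: "0 \<le> \<epsilon>"
    and sim: "\<And>D. countable D \<Longrightarrow> \<exists>b\<in>B. \<forall>z\<in>D. blinfun_apply b z = T z e"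
    and y: "y \<in> (\<Inter>k\<in>{1..}. {c + \<epsilon> *\<^sub>R u | c u.
        c \<in> sigma_topology B closure_of (convex hull {x n | n. n \<ge> k}) \<and> u \<in> cball 0 1})"
  shows "(\<And>j. i \<le> j \<Longrightarrow> t \<le> T (x j) e) \<Longrightarrow> t - \<epsilon> \<le> T y e"
    and "(\<And>j. i \<le> j \<Longrightarrow> T (x j) e \<le> t) \<Longrightarrow> T y e \<le> t + \<epsilon>"
proof -
  define k where "k = max i 1"
  obtain c u where c: "c \<in> sigma_topology B closure_of (convex hull {x n | n. n \<ge> k})"
    and u: "norm u \<le> 1" and yc: "y = c + \<epsilon> *\<^sub>R u"
    using INT_D[OF y, of k] by (auto simp: k_def)
  obtain b where b: "b \<in> B" "\<And>z. z \<in> insert y (range x) \<Longrightarrow> blinfun_apply b z = T z e"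
    using sim[of "insert y (range x)"] by auto
  have "norm b = 1" using b(1) B by auto
  then have "\<bar>blinfun_apply b u\<bar> \<le> 1" using norm_blinfun[of b u] u by simp
  then have "\<bar>\<epsilon> * blinfun_apply b u\<bar> \<le> \<epsilon> * 1"
    using \<epsilon> unfolding abs_mult by (intro mult_mono) auto
  moreover have "T y e = blinfun_apply b c + \<epsilon> * blinfun_apply b u"
    using b(2)[of y] by (simp add: yc blinfun.add_right blinfun.scaleR_right)
  ultimately have near: "\<bar>T y e - blinfun_apply b c\<bar> \<le> \<epsilon>" by simp
  have in_C: "blinfun_apply b c \<in> C"
    if "closed C" "convex C" "\<And>j. i \<le> j \<Longrightarrow> T (x j) e \<in> C" for C
    by (rule sigma_closure_convex_hull_subset[OF b(1) that(1,2) _ c]) (use b(2) that(3) in \<open>auto simp: k_def\<close>)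
  show "t - \<epsilon> \<le> T y e" if "\<And>j. i \<le> j \<Longrightarrow> t \<le> T (x j) e"
    using in_C[of "{t..}"] that near by simp
  show "T y e \<le> t + \<epsilon>" if "\<And>j. i \<le> j \<Longrightarrow> T (x j) e \<le> t"
    using in_C[of "{..t}"] that near by simp
qed

text \<open>
  \<open>T\<close> embeds the space into \<open>C(E)\<close>, and there \<open>f\<close> is dominated by the maximum because
  \<open>T x\<close> somewhere reaches the norm of \<open>x\<close>. A linear functional dominated by the maximum is positive and normalised.
\<close>

lemma mean_extending_functional:
  fixes T :: "'x::real_normed_vector \<Rightarrow> 'e::topological_space \<Rightarrow> real"
  assumes comp: "compact (UNIV :: 'e set)"
    and T: "\<And>x. continuous_on UNIV (T x)" "\<And>e. linear (\<lambda>x. T x e)" "\<And>x. \<exists>e. norm x \<le> T x e"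
    and f: "norm f \<le> 1"
  obtains \<mu> where "mean \<mu>" "\<And>x. \<mu> (T x) = blinfun_apply f x"
proof -
  have mem: "g \<in> bcontfun" if "continuous_on UNIV g" for g :: "'e \<Rightarrow> real"
    using that compact_imp_bounded[OF compact_continuous_image[OF that comp]] by (simp add: bcontfun_def)
  have ap: "apply_bcontfun (Bcontfun g) = g" if "continuous_on UNIV g" for g :: "'e \<Rightarrow> real"
    using mem[OF that] by (simp add: Bcontfun_inverse)
  define p where "p h = (SUP e. apply_bcontfun h e)" for h :: "'e \<Rightarrow>\<^sub>C real"
  have p_upper: "apply_bcontfun h e \<le> p h" for h e
    unfolding p_def by (rule cSUP_upper) (auto intro: bounded_imp_bdd_above)
  have p_least: "p h \<le> c" if "\<And>e. apply_bcontfun h e \<le> c" for h c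
    unfolding p_def using that by (intro cSUP_least) auto
  have p: "sublinear p"
  proof (rule sublinearI)
    show "p (u + v) \<le> p u + p v" for u v
      by (rule p_least) (simp add: add_mono p_upper)
    show "p (c *\<^sub>R u) \<le> c * p u" if "c > 0" for c u
      using that by (intro p_least) (simp add: p_upper)
    show "p 0 = 0" by (simp add: p_def)
  qed
  have lin: "linear (\<lambda>x. Bcontfun (T x))"
  proof (rule linearI; rule bcontfun_eqI)
    fix x y e and c :: real
    show "apply_bcontfun (Bcontfun (T (x + y))) e = apply_bcontfun (Bcontfun (T x) + Bcontfun (T y)) e"
      using linear_add[OF T(2)[of e]] by (simp add: ap T(1))
    show "apply_bcontfun (Bcontfun (T (c *\<^sub>R x))) e = apply_bcontfun (c *\<^sub>R Bcontfun (T x)) e"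
      using linear_scale[OF T(2)[of e]] by (simp add: ap T(1))
  qed
  have dom: "blinfun_apply f x \<le> p (Bcontfun (T x))" for x
  proof -
    obtain e where e: "norm x \<le> T x e" using T(3) by blast
    have "blinfun_apply f x \<le> norm f * norm x" using norm_blinfun[of f x] by simp
    also have "\<dots> \<le> 1 * norm x" using f by (intro mult_right_mono) auto
    also have "\<dots> \<le> apply_bcontfun (Bcontfun (T x)) e" using e by (simp add: ap T(1))
    finally show ?thesis using p_upper order.trans by blast
  qed
  obtain F where F: "linear F" "\<And>h. F h \<le> p h" "\<And>x. F (Bcontfun (T x)) = blinfun_apply f x"
    using Hahn_Banach_dominated[OF p lin bounded_linear.linear[OF blinfun.bounded_linear_right] subspace_UNIV dom]
    by auto
  have "mean (\<lambda>g. F (Bcontfun g))"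
    unfolding mean_def
  proof (intro conjI allI impI)
    fix g h :: "'e \<Rightarrow> real" and c :: real
    assume g: "continuous_on UNIV g"
    have "Bcontfun (\<lambda>e. c * g e) = c *\<^sub>R Bcontfun g"
      by (rule bcontfun_eqI) (simp add: ap g continuous_on_mult_left)
    then show "F (Bcontfun (\<lambda>e. c * g e)) = c * F (Bcontfun g)" by (simp add: linear_scale[OF F(1)])
    assume h: "continuous_on UNIV h"
    have "Bcontfun (\<lambda>e. g e + h e) = Bcontfun g + Bcontfun h"
      by (rule bcontfun_eqI) (simp add: ap g h continuous_on_add)
    then show "F (Bcontfun (\<lambda>e. g e + h e)) = F (Bcontfun g) + F (Bcontfun h)"
      by (simp add: linear_add[OF F(1)])
    assume le: "\<forall>e. g e \<le> h e"
    have "F (Bcontfun g - Bcontfun h) \<le> p (Bcontfun g - Bcontfun h)" by (rule F(2))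
    also have "\<dots> \<le> 0" using le by (intro p_least) (simp add: ap g h)
    finally show "F (Bcontfun g) \<le> F (Bcontfun h)" by (simp add: linear_diff[OF F(1)])
  next
    have eq: "Bcontfun (\<lambda>_::'e. 1::real) = const_bcontfun 1"
      by (rule bcontfun_eqI) (simp add: ap)
    have "F (const_bcontfun 1) \<le> 1"
      using F(2)[of "const_bcontfun 1"] by (simp add: p_def)
    moreover have "F (- const_bcontfun 1) \<le> - 1"
      using F(2)[of "- const_bcontfun 1"] by (simp add: p_def)
    ultimately show "F (Bcontfun (\<lambda>_. 1)) = 1" by (simp add: eq linear_neg[OF F(1)])
  qed
  then show thesis using F(3) that by blast
qed

text \<open>
  A functional at distance more than \<open>2 * \<epsilon>\<close> leads, through the array of functionals and their means,
  to points \<open>es i\<close> and \<open>e\<close> with the gap \<open>d\<close>. The vector \<open>y\<close> of the hypothesis bridges at most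
  \<open>2 * \<epsilon>\<close> of it, provided that its values at the \<open>es i\<close> accumulate at its value at \<open>e\<close>. The \<open>es i\<close>
  tend to \<open>e\<close> only as far as the \<open>x k\<close> can tell, so \<open>e\<close> is replaced by a cluster point \<open>e'\<close> of the
  \<open>es i\<close>, at which the \<open>x k\<close> have the same values as at \<open>e\<close>.
\<close>

lemma delta_WRC_if_countably_simulated:
  fixes T :: "'x::real_normed_vector \<Rightarrow> 'e::topological_space \<Rightarrow> real"
  assumes comp: "compact (UNIV :: 'e set)"
    and T: "\<And>x. continuous_on UNIV (T x)" "\<And>e. linear (\<lambda>x. T x e)"
      "\<And>x e. T x e \<le> norm x" "\<And>x. \<exists>e. norm x \<le> T x e"
    and B: "B \<subseteq> sphere 0 1"
    and sim: "\<And>D e. countable D \<Longrightarrow> \<exists>b\<in>B. \<forall>z\<in>D. blinfun_apply b z = T z e"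
    and A: "bounded A" and \<epsilon>: "0 \<le> \<epsilon>"
    and H: "\<And>x :: nat \<Rightarrow> 'x. (\<And>n. x n \<in> A) \<Longrightarrow>
      (\<Inter>k\<in>{1..}. {c + \<epsilon> *\<^sub>R u | c u.
        c \<in> sigma_topology B closure_of (convex hull {x n | n. n \<ge> k}) \<and> u \<in> cball 0 1}) \<noteq> {}"
  shows "delta_WRC (2 * \<epsilon>) A"
  unfolding delta_WRC_def
proof (intro conjI ballI A)
  fix \<phi> assume \<phi>: "\<phi> \<in> strong_operator_topology closure_of (bidual_embedding ` A)"
  show "infdist \<phi> (range bidual_embedding) \<le> 2 * \<epsilon>"
  proof (rule ccontr)
    assume "\<not> ?thesis"
    then obtain d where d: "2 * \<epsilon> < d" "d < infdist \<phi> (range bidual_embedding)"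
      using dense by (auto simp: not_le)
    have d0: "0 \<le> d" using d(1) \<epsilon> by simp
    obtain f :: "nat \<Rightarrow> 'x \<Rightarrow>\<^sub>L real" and x :: "nat \<Rightarrow> 'x"
      where fx: "\<And>m. norm (f m) \<le> 1" "\<And>n. x n \<in> A"
        "\<And>m n. n < m \<Longrightarrow> blinfun_apply (f m) (x n) = 0"
        "\<And>m n. m \<le> n \<Longrightarrow> d < blinfun_apply (f m) (x n)"
      by (rule triangular_system[OF \<phi> d(2) d0]) blast
    have "\<exists>\<mu>. mean \<mu> \<and> (\<forall>z. \<mu> (T z) = blinfun_apply (f m) z)" for m
    proof (rule mean_extending_functional[OF comp T(1,2,4) fx(1)[of m]])
      fix \<nu> assume "mean \<nu>" "\<And>z. \<nu> (T z) = blinfun_apply (f m) z"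
      then show ?thesis by (intro exI[of _ \<nu>]) simp
    qed
    then have "\<exists>\<mu>. \<forall>m. mean (\<mu> m) \<and> (\<forall>z. \<mu> m (T z) = blinfun_apply (f m) z)" by (intro choice allI)
    then obtain \<mu> where \<mu>: "\<And>m. mean (\<mu> m)" "\<And>m z. \<mu> m (T z) = blinfun_apply (f m) z" by auto
    obtain M where M: "\<And>z. z \<in> A \<Longrightarrow> norm z \<le> M" using A by (auto simp: bounded_iff)
    have bd: "\<bar>T (x n) e\<bar> \<le> M" for n e
      using T(3)[of "x n" e] T(3)[of "- x n" e] M[OF fx(2)[of n]] by (simp add: linear_neg[OF T(2)])
    \<comment> \<open>The extraction loses \<open>3 * \<delta>\<close>, which has to stay below \<open>d - 2 * \<epsilon>\<close>.\<close>
    define \<delta> where "\<delta> = (d - 2 * \<epsilon>) / 4"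
    have \<delta>: "0 < \<delta>" using d(1) by (simp add: \<delta>_def)
    have above: "d \<le> \<mu> m (T (x n))" if "m \<le> n" for m n
      using fx(4)[OF that] by (simp add: \<mu>(2))
    have below: "\<mu> m (T (x n)) \<le> 0" if "n < m" for m n
      using fx(3)[OF that] by (simp add: \<mu>(2))
    obtain t \<sigma> e es where \<sigma>: "strict_mono (\<sigma> :: nat \<Rightarrow> nat)"
      "\<And>i j :: nat. i \<le> j \<Longrightarrow> t \<le> T (x (\<sigma> j)) (es i)" "\<And>j. T (x (\<sigma> j)) e \<le> t + 3 * \<delta> - d"
      "\<And>k. (\<lambda>i. T (x k) (es i)) \<longlonglongrightarrow> T (x k) e"
    proof (rule double_limit_extraction[of \<mu> "\<lambda>n. T (x n)" M \<delta> d, OF comp \<mu>(1) T(1) bd \<delta> above below])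
      fix t \<sigma> e es
      assume "strict_mono (\<sigma> :: nat \<Rightarrow> nat)"
        "\<And>i j. i \<le> j \<Longrightarrow> t \<le> T (x (\<sigma> j)) (es i)" "\<And>j. T (x (\<sigma> j)) e \<le> t + 3 * \<delta> - d"
        "\<And>k. (\<lambda>i. T (x k) (es i)) \<longlonglongrightarrow> T (x k) e"
      then show thesis by (rule that)
    qed
    obtain y where y: "y \<in> (\<Inter>k\<in>{1..}. {c + \<epsilon> *\<^sub>R u | c u.
        c \<in> sigma_topology B closure_of (convex hull {x (\<sigma> n) | n. n \<ge> k}) \<and> u \<in> cball 0 1})"
      using H[of "\<lambda>n. x (\<sigma> n)", OF fx(2)] unfolding ex_in_conv[symmetric] by (elim exE)
    have y_es: "t - \<epsilon> \<le> T y (es i)" for i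
      by (rule asymptotic_bounds(1)[where x = "\<lambda>n. x (\<sigma> n)" and e = "es i" and i = i, OF B \<epsilon> sim y]) (use \<sigma>(2) in auto)
    obtain e' where e': "inf (nhds e') (filtermap es sequentially) \<noteq> bot"
      using comp[unfolded compact_filter, rule_format, of "filtermap es sequentially"]
      by (auto simp: filtermap_bot_iff)
    define G where "G = inf (nhds e') (filtermap es sequentially)"
    have lim_e': "(T z \<longlongrightarrow> T z e') G" for z
    proof (rule tendsto_mono)
      have "(T z \<longlongrightarrow> T z e') (at e')" using T(1)[of z] by (simp add: continuous_on_def)
      then show "(T z \<longlongrightarrow> T z e') (nhds e')" by (simp add: tendsto_at_iff_tendsto_nhds)
    qed (simp add: G_def)
    have "T (x k) e' = T (x k) e" for k
    proof (rule tendsto_unique[OF _ lim_e'])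
      show "G \<noteq> bot" using e' by (simp add: G_def)
      have "(T (x k) \<longlongrightarrow> T (x k) e) (filtermap es sequentially)"
        using \<sigma>(4)[of k] by (simp add: filterlim_filtermap)
      then show "(T (x k) \<longlongrightarrow> T (x k) e) G" by (rule tendsto_mono[rotated]) (simp add: G_def)
    qed
    then have "T (x (\<sigma> j)) e' \<le> t + 3 * \<delta> - d" for j using \<sigma>(3)[of j] by simp
    then have "T y e' \<le> t + 3 * \<delta> - d + \<epsilon>"
      by (intro asymptotic_bounds(2)[where x = "\<lambda>n. x (\<sigma> n)" and e = e' and i = 0, OF B \<epsilon> sim y]) auto
    moreover have "t - \<epsilon> \<le> T y e'"
    proof (rule tendsto_lowerbound[OF lim_e'])
      have "\<forall>\<^sub>F e in filtermap es sequentially. t - \<epsilon> \<le> T y e"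
        using y_es by (simp add: eventually_filtermap)
      then show "\<forall>\<^sub>F e in G. t - \<epsilon> \<le> T y e" by (rule filter_leD[rotated]) (simp add: G_def)
      show "G \<noteq> bot" using e' by (simp add: G_def)
    qed
    ultimately show False using d(1) by (simp add: \<delta>_def field_simps)
  qed
qed

section \<open>Spaces of continuous functions\<close>

definition sign_of :: "bool \<Rightarrow> real" where "sign_of b = (if b then 1 else - 1)"

lemma abs_sign_of [simp]: "\<bar>sign_of b\<bar> = 1"
  and sign_of_mult_self [simp]: "sign_of b * sign_of b = 1"
  by (simp_all add: sign_of_def)

lemma sign_of_mult_le: "sign_of b * r \<le> \<bar>r\<bar>"
  by (cases b) (auto simp: sign_of_def)

lemma continuous_on_sign_of:
  fixes f :: "'a::topological_space \<Rightarrow> bool"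
  assumes "continuous_on S f" shows "continuous_on S (\<lambda>e. sign_of (f e))"
  using continuous_on_compose[OF assms Topological_Spaces.continuous_on_discrete[of _ sign_of]] by (simp add: comp_def)

lemma boundary_attains_norm:
  assumes "boundary B"
  obtains b where "b \<in> B" "blinfun_apply b x = norm x" "norm b = 1"
proof -
  obtain b where b: "b \<in> B" "blinfun_apply b x = norm x" using assms unfolding boundary_def by blast
  moreover have "b \<in> sphere 0 1" using assms b(1) unfolding boundary_def by blast
  ultimately show thesis using that by simp
qed

text \<open>
  Let \<open>V \<ge> 0\<close> be a continuous function with values at most 1 that vanishes at \<open>k\<close> and dominates a multiple
  of \<open>\<bar>f - f(k)\<bar>\<close> for every \<open>f \<in> D\<close>. If \<open>b \<in> B\<close> attains the norm of \<open>\<plusminus> (1 - V)\<close>, then adding or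
  subtracting any \<open>y\<close> with \<open>\<bar>y\<bar> \<le> V\<close> does not increase the norm beyond 1, so \<open>b(y) = 0\<close>. Hence
  \<open>b(V) = 0\<close>, which gives \<open>b(1) = \<plusminus> 1\<close>, and then \<open>b(f) = \<plusminus> f(k)\<close> on \<open>D\<close>.
\<close>

lemma boundary_simulates_points:
  fixes B :: "(('k::topological_space \<Rightarrow>\<^sub>C real) \<Rightarrow>\<^sub>L real) set"
  assumes B: "boundary B" and D: "countable D"
  shows "\<exists>b\<in>B. \<forall>f\<in>D. blinfun_apply b f = sign_of s * apply_bcontfun f k"
proof -
  define F where "F = from_nat_into (insert 0 D)"
  have DF: "D \<subseteq> range F" using D by (auto simp: F_def range_from_nat_into)
  define \<nu> where "\<nu> n = (1/2) ^ Suc n / (1 + 2 * norm (F n))" for n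
  have \<nu>: "0 < \<nu> n" for n by (simp add: \<nu>_def add_pos_nonneg)
  define v where "v n e = \<nu> n * \<bar>apply_bcontfun (F n) e - apply_bcontfun (F n) k\<bar>" for n e
  have v0: "0 \<le> v n e" for n e using \<nu>[of n] by (simp add: v_def)
  have v_le: "v n e \<le> (1/2) ^ Suc n" for n e
  proof -
    have "\<bar>apply_bcontfun (F n) e - apply_bcontfun (F n) k\<bar> \<le> 1 + 2 * norm (F n)"
      using norm_bounded[of "F n" e] norm_bounded[of "F n" k] by simp
    then have "v n e \<le> \<nu> n * (1 + 2 * norm (F n))"
      using \<nu>[of n] unfolding v_def by (intro mult_left_mono) auto
    also have "\<dots> = (1/2) ^ Suc n"
    proof -
      have "1 + 2 * norm (F n) \<noteq> 0" using add_pos_nonneg[of 1 "2 * norm (F n)"] by simp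
      then show ?thesis unfolding \<nu>_def times_divide_eq_left by (rule nonzero_mult_div_cancel_right)
    qed
    finally show ?thesis .
  qed
  have geo: "summable (\<lambda>n. (1/2::real) ^ Suc n)" "(\<Sum>n. (1/2::real) ^ Suc n) = 1"
    using power_half_series by (auto simp: sums_iff)
  define V where "V e = (\<Sum>n. v n e)" for e
  have sm: "summable (\<lambda>n. v n e)" for e
    by (rule summable_comparison_test'[OF geo(1)]) (use v0 v_le in auto)
  have v_V: "v n e \<le> V e" for n e
    unfolding V_def using sum_le_suminf[OF sm, of "{n}" e] v0 by simp
  have V01: "0 \<le> V e" "V e \<le> 1" for e
    using suminf_nonneg[OF sm v0] suminf_le[OF v_le sm geo(1)] geo(2) by (auto simp: V_def)
  have Vk: "V k = 0" by (simp add: V_def v_def)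
  have "continuous_on UNIV V"
  proof (rule uniform_limit_theorem)
    show "\<forall>\<^sub>F n in sequentially. continuous_on UNIV (\<lambda>e. \<Sum>i<n. v i e)"
      unfolding v_def by (intro always_eventually allI continuous_intros) auto
    show "uniform_limit UNIV (\<lambda>n e. \<Sum>i<n. v i e) V sequentially"
      unfolding V_def by (rule Weierstrass_m_test[OF _ geo(1)]) (use v0 v_le in auto)
  qed simp
  then have "V \<in> bcontfun" using V01 by (intro bcontfun_normI[of _ 1]) auto
  then obtain W where W: "apply_bcontfun W = V" by (metis bcontfunE)
  define one where "one = (const_bcontfun 1 :: 'k \<Rightarrow>\<^sub>C real)"
  define g where "g = sign_of s *\<^sub>R (one - W)"
  have "norm g = 1"
  proof (rule antisym)
    show "norm g \<le> 1" using V01 by (intro norm_bound) (simp add: g_def one_def W abs_mult)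
    show "1 \<le> norm g" using norm_bounded[of g k] by (simp add: g_def one_def W Vk)
  qed
  then obtain b where b: "b \<in> B" "blinfun_apply b g = 1" "norm b = 1"
    using boundary_attains_norm[OF B, of g] by metis
  have le1: "blinfun_apply b y \<le> 1" if "norm y \<le> 1" for y
    using norm_blinfun[of b y] b(3) that by simp
  have vanish: "blinfun_apply b y = 0" if y: "\<And>e. \<bar>apply_bcontfun y e\<bar> \<le> V e" for y
  proof -
    have bd: "\<bar>sign_of s * (1 - V e)\<bar> + \<bar>apply_bcontfun y e\<bar> \<le> 1" for e
      using y[of e] V01[of e] by (simp add: abs_mult)
    have "norm (g + y) \<le> 1"
    proof (rule norm_bound)
      fix e show "norm (apply_bcontfun (g + y) e) \<le> 1"
        using order.trans[OF abs_triangle_ineq bd[of e]] by (simp add: g_def one_def W)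
    qed
    moreover have "norm (g - y) \<le> 1"
    proof (rule norm_bound)
      fix e show "norm (apply_bcontfun (g - y) e) \<le> 1"
        using order.trans[OF abs_triangle_ineq4 bd[of e]] by (simp add: g_def one_def W)
    qed
    ultimately show ?thesis
      using le1[of "g + y"] le1[of "g - y"] b(2) by (simp add: blinfun.add_right blinfun.diff_right)
  qed
  have "blinfun_apply b W = 0" using V01 by (intro vanish) (simp add: W)
  then have "sign_of s * blinfun_apply b one = 1"
    using b(2) by (simp add: g_def blinfun.scaleR_right blinfun.diff_right)
  then have one: "blinfun_apply b one = sign_of s" by (auto simp: sign_of_def split: if_splits)
  have "blinfun_apply b (F n) = sign_of s * apply_bcontfun (F n) k" for n
  proof -
    have "blinfun_apply b (\<nu> n *\<^sub>R (F n - apply_bcontfun (F n) k *\<^sub>R one)) = 0"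
    proof (rule vanish)
      fix e show "\<bar>apply_bcontfun (\<nu> n *\<^sub>R (F n - apply_bcontfun (F n) k *\<^sub>R one)) e\<bar> \<le> V e"
        using v_V[of n e] \<nu>[of n] by (simp add: v_def one_def abs_mult)
    qed
    then show ?thesis using \<nu>[of n]
      by (simp add: blinfun.scaleR_right blinfun.diff_right one mult.commute)
  qed
  with b(1) DF show ?thesis by (intro bexI[of _ b]) auto
qed

lemma delta_WRC_continuous_functions:
  fixes B :: "(('k::topological_space \<Rightarrow>\<^sub>C real) \<Rightarrow>\<^sub>L real) set"
  assumes comp: "compact (UNIV :: 'k set)" and B: "boundary B"
    and A: "bounded A" and \<epsilon>: "0 \<le> \<epsilon>"
    and H: "\<And>x :: nat \<Rightarrow> 'k \<Rightarrow>\<^sub>C real. (\<And>n. x n \<in> A) \<Longrightarrow>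
      (\<Inter>k\<in>{1..}. {c + \<epsilon> *\<^sub>R u | c u.
        c \<in> sigma_topology B closure_of (convex hull {x n | n. n \<ge> k}) \<and> u \<in> cball 0 1}) \<noteq> {}"
  shows "delta_WRC (2 * \<epsilon>) A"
proof (rule delta_WRC_if_countably_simulated[where T = "\<lambda>f e. sign_of (snd e) * apply_bcontfun f (fst e)"])
  have "compact (UNIV \<times> UNIV :: ('k \<times> bool) set)"
    by (intro compact_Times comp finite_imp_compact) simp
  then show "compact (UNIV :: ('k \<times> bool) set)" by simp
  fix f :: "'k \<Rightarrow>\<^sub>C real"
  show "continuous_on UNIV (\<lambda>e. sign_of (snd e) * apply_bcontfun f (fst e))"
    by (intro continuous_on_mult continuous_on_sign_of continuous_on_snd continuous_on_id
        continuous_on_compose2[OF continuous_on_apply_bcontfun[of UNIV f]] continuous_on_fst) auto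
  show "sign_of (snd e) * apply_bcontfun f (fst e) \<le> norm f" for e
    using sign_of_mult_le[of "snd e" "apply_bcontfun f (fst e)"] norm_bounded[of f "fst e"] by simp
  have "continuous_on UNIV (\<lambda>k. \<bar>apply_bcontfun f k\<bar>)" by (intro continuous_intros) simp
  then obtain k where k: "\<And>j. \<bar>apply_bcontfun f j\<bar> \<le> \<bar>apply_bcontfun f k\<bar>"
    using continuous_attains_sup[OF comp, of "\<lambda>k. \<bar>apply_bcontfun f k\<bar>"] by auto
  have "norm f \<le> \<bar>apply_bcontfun f k\<bar>" by (rule norm_bound) (simp add: k)
  also have "\<dots> = sign_of (0 \<le> apply_bcontfun f k) * apply_bcontfun f k" by (simp add: sign_of_def)
  finally show "\<exists>e. norm f \<le> sign_of (snd e) * apply_bcontfun f (fst e)"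
    by (intro exI[of _ "(k, 0 \<le> apply_bcontfun f k)"]) simp
next
  show "linear (\<lambda>f. sign_of (snd e) * apply_bcontfun f (fst e))" for e :: "'k \<times> bool"
    by (rule linearI) (simp_all add: algebra_simps)
  show "B \<subseteq> sphere 0 1" using B by (simp add: boundary_def)
  show "\<exists>b\<in>B. \<forall>f\<in>D. blinfun_apply b f = sign_of (snd e) * apply_bcontfun f (fst e)"
    if "countable D" for D and e :: "'k \<times> bool"
    using boundary_simulates_points[OF B that, of "snd e" "fst e"] .
qed (use A \<epsilon> H in auto)

section \<open>Spaces of absolutely summable families\<close>

definition signed_sum :: "'i ell1 \<Rightarrow> ('i \<Rightarrow> bool) \<Rightarrow> real" where
  "signed_sum x e = (\<Sum>\<^sub>\<infinity>i. sign_of (e i) * apply_ell1 x i)"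

lemma ell1_abs_summable: "(\<lambda>i. \<bar>apply_ell1 x i\<bar>) summable_on S"
  using apply_ell1[of x] by (auto intro: summable_on_subset_banach)

lemma signed_summable: "(\<lambda>i. sign_of (e i) * apply_ell1 x i) summable_on S"
  by (rule abs_summable_summable) (simp add: abs_mult ell1_abs_summable)

lemma linear_signed_sum: "linear (\<lambda>x. signed_sum x e)"
proof (rule linearI)
  show "signed_sum (x + y) e = signed_sum x e + signed_sum y e" for x y
    unfolding signed_sum_def plus_ell1.rep_eq distrib_left
    by (rule infsum_add) (rule signed_summable)+
  show "signed_sum (c *\<^sub>R x) e = c *\<^sub>R signed_sum x e" for c x
    unfolding signed_sum_def scaleR_ell1.rep_eq
    by (simp add: mult.left_commute infsum_cmult_right')
qed

lemma signed_sum_le_norm: "signed_sum x e \<le> norm x"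
  unfolding signed_sum_def norm_ell1.rep_eq
  by (intro infsum_mono signed_summable ell1_abs_summable sign_of_mult_le)

lemma signed_sum_eq_norm:
  assumes "\<And>i. 0 \<le> sign_of (e i) * apply_ell1 x i" shows "signed_sum x e = norm x"
  unfolding signed_sum_def norm_ell1.rep_eq
proof (rule infsum_cong)
  fix i show "sign_of (e i) * apply_ell1 x i = \<bar>apply_ell1 x i\<bar>"
    using assms[of i] by (auto simp: sign_of_def split: if_splits)
qed

text \<open>
  The finite partial sums depend on finitely many signs, and they converge uniformly because the
  tails are bounded by tails of the norm.
\<close>

lemma continuous_on_signed_sum: "continuous_on UNIV (signed_sum x)"
proof (rule uniform_limit_theorem[where F = "finite_subsets_at_top UNIV"])
  have "continuous_on UNIV (\<lambda>e. \<Sum>i\<in>F. sign_of (e i) * apply_ell1 x i)" for F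
    by (intro continuous_intros continuous_on_sign_of continuous_on_product_coordinates)
  then show "\<forall>\<^sub>F F in finite_subsets_at_top UNIV.
      continuous_on UNIV (\<lambda>e. \<Sum>i\<in>F. sign_of (e i) * apply_ell1 x i)" by simp
  show "uniform_limit UNIV (\<lambda>F e. \<Sum>i\<in>F. sign_of (e i) * apply_ell1 x i) (signed_sum x)
      (finite_subsets_at_top UNIV)"
  proof (rule uniform_limitI)
    fix r :: real assume r: "0 < r"
    have "((\<lambda>F. \<Sum>i\<in>F. \<bar>apply_ell1 x i\<bar>) \<longlongrightarrow> norm x) (finite_subsets_at_top UNIV)"
      unfolding norm_ell1.rep_eq by (rule infsum_tendsto[OF ell1_abs_summable])
    then have "\<forall>\<^sub>F F in finite_subsets_at_top UNIV. norm x - r < (\<Sum>i\<in>F. \<bar>apply_ell1 x i\<bar>)"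
      using r by (intro order_tendstoD(1)) auto
    moreover have "\<forall>\<^sub>F F in finite_subsets_at_top UNIV. finite (F :: 'a set)"
      by (rule eventually_finite_subsets_at_top_weakI) simp
    ultimately show "\<forall>\<^sub>F F in finite_subsets_at_top UNIV.
        \<forall>e\<in>UNIV. dist (\<Sum>i\<in>F. sign_of (e i) * apply_ell1 x i) (signed_sum x e) < r"
    proof eventually_elim
      case (elim F)
      have split: "infsum f UNIV = sum f F + infsum f (- F)"
        if "\<And>S. f summable_on S" for f :: "'a \<Rightarrow> real"
        using infsum_Un_disjoint[OF that[of F] that[of "- F"]] elim(2) by simp
      show ?case
      proof
        fix e
        have "dist (\<Sum>i\<in>F. sign_of (e i) * apply_ell1 x i) (signed_sum x e)
            = \<bar>\<Sum>\<^sub>\<infinity>i\<in>- F. sign_of (e i) * apply_ell1 x i\<bar>"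
          unfolding signed_sum_def split[OF signed_summable] dist_real_def by simp
        also have "\<dots> \<le> (\<Sum>\<^sub>\<infinity>i\<in>- F. \<bar>sign_of (e i) * apply_ell1 x i\<bar>)"
          using norm_infsum_bound[of "\<lambda>i. sign_of (e i) * apply_ell1 x i" "- F"]
          by (simp add: abs_mult ell1_abs_summable)
        also have "\<dots> = (\<Sum>\<^sub>\<infinity>i\<in>- F. \<bar>apply_ell1 x i\<bar>)" by (simp add: abs_mult)
        also have "\<dots> < r"
          using elim(1) split[OF ell1_abs_summable[of x]] by (simp add: norm_ell1.rep_eq)
        finally show "dist (\<Sum>i\<in>F. sign_of (e i) * apply_ell1 x i) (signed_sum x e) < r" .
      qed
    qed
  qed
qed simp

text \<open>
  Choose \<open>z\<close> with the signs of \<open>e\<close> whose modulus dominates a multiple of every \<open>x \<in> D\<close>, and let \<open>b \<in> B\<close> attain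
  its norm. A perturbation \<open>y\<close> dominated by \<open>z\<close> does not change the signs, so the norm is additive:
  \<open>norm (z \<plusminus> y) = norm z \<plusminus> signed_sum y e\<close>. Since \<open>b\<close> is bounded by the norm and exact at \<open>z\<close>, it
  agrees with the signed sum at \<open>y\<close>.
\<close>

lemma boundary_simulates_signs:
  fixes B :: "('i ell1 \<Rightarrow>\<^sub>L real) set"
  assumes B: "boundary B" and D: "countable D"
  shows "\<exists>b\<in>B. \<forall>x\<in>D. blinfun_apply b x = signed_sum x e"
proof -
  define F where "F = from_nat_into (insert 0 D)"
  have DF: "D \<subseteq> range F" using D by (auto simp: F_def range_from_nat_into)
  define \<nu> where "\<nu> n = (1/2) ^ Suc n / (1 + norm (F n))" for n
  have \<nu>: "0 < \<nu> n" for n by (simp add: \<nu>_def add_pos_nonneg)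
  define w where "w n = Abs_ell1 (\<lambda>i. sign_of (e i) * \<bar>apply_ell1 (F n) i\<bar>)" for n
  have w: "apply_ell1 (w n) i = sign_of (e i) * \<bar>apply_ell1 (F n) i\<bar>" for n i
    unfolding w_def by (subst Abs_ell1_inverse) (simp_all add: abs_mult ell1_abs_summable)
  have w_norm: "norm (w n) = norm (F n)" for n
    unfolding norm_ell1.rep_eq w by (simp add: abs_mult)
  have a_le: "norm (\<nu> n *\<^sub>R w n) \<le> (1/2) ^ Suc n" for n
  proof -
    have "norm (\<nu> n *\<^sub>R w n) = \<nu> n * norm (F n)" using \<nu>[of n] by (simp add: w_norm)
    also have "\<dots> \<le> \<nu> n * (1 + norm (F n))" using \<nu>[of n] by (intro mult_left_mono) auto
    also have "\<dots> = (1/2) ^ Suc n"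
    proof -
      have "1 + norm (F n) \<noteq> 0" using add_pos_nonneg[of 1 "norm (F n)"] by simp
      then show ?thesis unfolding \<nu>_def times_divide_eq_left by (rule nonzero_mult_div_cancel_right)
    qed
    finally show ?thesis .
  qed
  have "summable (\<lambda>n. (1/2::real) ^ Suc n)"
    using power_half_series by (auto simp: sums_iff)
  then have sw: "summable (\<lambda>n. \<nu> n *\<^sub>R w n)"
    by (rule summable_comparison_test') (rule a_le)
  define z where "z = (\<Sum>n. \<nu> n *\<^sub>R w n)"
  have coord: "bounded_linear (\<lambda>x. sign_of (e i) * apply_ell1 x i)" for i
  proof (rule bounded_linear_intro[where K = 1])
    show "norm (sign_of (e i) * apply_ell1 x i) \<le> norm x * 1" for x
      using ell1_sum_le_norm[of "{i}" x] by (simp add: abs_mult)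
  qed (simp_all add: plus_ell1.rep_eq scaleR_ell1.rep_eq algebra_simps)
  have z_dom: "\<nu> n * \<bar>apply_ell1 (F n) i\<bar> \<le> sign_of (e i) * apply_ell1 z i" for n i
  proof -
    have coord_w: "sign_of (e i) * apply_ell1 (\<nu> m *\<^sub>R w m) i = \<nu> m * \<bar>apply_ell1 (F m) i\<bar>" for m
      by (simp add: scaleR_ell1.rep_eq w sign_of_def)
    have "\<nu> n * \<bar>apply_ell1 (F n) i\<bar> \<le> (\<Sum>m. \<nu> m * \<bar>apply_ell1 (F m) i\<bar>)"
      using sum_le_suminf[of "\<lambda>m. \<nu> m * \<bar>apply_ell1 (F m) i\<bar>" "{n}"]
        bounded_linear.summable[OF coord[of i] sw] \<nu> by (simp add: coord_w less_imp_le)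
    also have "\<dots> = sign_of (e i) * apply_ell1 z i"
      unfolding z_def bounded_linear.suminf[OF coord sw] coord_w ..
    finally show ?thesis .
  qed
  obtain b where b: "b \<in> B" "blinfun_apply b z = norm z" "norm b = 1"
    by (rule boundary_attains_norm[OF B])
  have dominated: "blinfun_apply b y = signed_sum y e"
    if y: "\<And>i. \<bar>apply_ell1 y i\<bar> \<le> sign_of (e i) * apply_ell1 z i" for y
  proof -
    have *: "blinfun_apply b u \<le> signed_sum u e" if "\<And>i. \<bar>apply_ell1 u i\<bar> \<le> sign_of (e i) * apply_ell1 z i" for u
    proof -
      have "0 \<le> sign_of (e i) * apply_ell1 (z + u) i" for i
        using that[of i] sign_of_mult_le[of "e i" "- apply_ell1 u i"]
        by (simp add: plus_ell1.rep_eq distrib_left)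
      then have "norm (z + u) = signed_sum z e + signed_sum u e"
        using signed_sum_eq_norm[of e "z + u"] linear_add[OF linear_signed_sum[of e], of z u] by simp
      moreover have "0 \<le> sign_of (e i) * apply_ell1 z i" for i
        using that[of i] abs_ge_zero[of "apply_ell1 u i"] by linarith
      then have "norm z = signed_sum z e" using signed_sum_eq_norm[of e z] by simp
      moreover have "blinfun_apply b (z + u) \<le> norm (z + u)"
        using norm_blinfun[of b "z + u"] b(3) by simp
      ultimately show ?thesis using b(2) by (simp add: blinfun.add_right)
    qed
    have "blinfun_apply b (- y) \<le> signed_sum (- y) e"
      by (rule *) (simp add: uminus_ell1.rep_eq y)
    with *[OF y] show ?thesis
      by (simp add: blinfun.minus_right linear_neg[OF linear_signed_sum])
  qed
  have "blinfun_apply b (F n) = signed_sum (F n) e" for n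
  proof -
    have "blinfun_apply b (\<nu> n *\<^sub>R F n) = signed_sum (\<nu> n *\<^sub>R F n) e"
      using z_dom[of n] \<nu>[of n] by (intro dominated) (simp add: scaleR_ell1.rep_eq abs_mult)
    then show ?thesis using \<nu>[of n]
      by (simp add: blinfun.scaleR_right linear_scale[OF linear_signed_sum])
  qed
  with b(1) DF show ?thesis by (intro bexI[of _ b]) auto
qed

lemma delta_WRC_ell1:
  fixes B :: "('i ell1 \<Rightarrow>\<^sub>L real) set"
  assumes B: "boundary B" and A: "bounded A" and \<epsilon>: "0 \<le> \<epsilon>"
    and H: "\<And>x :: nat \<Rightarrow> 'i ell1. (\<And>n. x n \<in> A) \<Longrightarrow>
      (\<Inter>k\<in>{1..}. {c + \<epsilon> *\<^sub>R u | c u.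
        c \<in> sigma_topology B closure_of (convex hull {x n | n. n \<ge> k}) \<and> u \<in> cball 0 1}) \<noteq> {}"
  shows "delta_WRC (2 * \<epsilon>) A"
proof (rule delta_WRC_if_countably_simulated[where T = signed_sum])
  have "compactin (product_topology (\<lambda>_. euclidean) UNIV) (PiE UNIV (\<lambda>_::'i. UNIV :: bool set))"
    unfolding compactin_PiE by (simp add: compactin_euclidean_iff finite_imp_compact)
  then show "compact (UNIV :: ('i \<Rightarrow> bool) set)"
    by (simp add: euclidean_product_topology compactin_euclidean_iff)
  show "\<exists>e. norm x \<le> signed_sum x e" for x
  proof
    have "signed_sum x (\<lambda>i. 0 \<le> apply_ell1 x i) = norm x"
      by (rule signed_sum_eq_norm) (simp add: sign_of_def)
    then show "norm x \<le> signed_sum x (\<lambda>i. 0 \<le> apply_ell1 x i)" by simp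
  qed
  show "B \<subseteq> sphere 0 1" using B by (simp add: boundary_def)
  show "\<exists>b\<in>B. \<forall>x\<in>D. blinfun_apply b x = signed_sum x e" if "countable D" for D e
    by (rule boundary_simulates_signs[OF B that])
qed (use continuous_on_signed_sum linear_signed_sum signed_sum_le_norm A \<epsilon> H in auto)

theorem corollary2p9:
  fixes \<epsilon> :: real
  assumes "\<epsilon> \<ge> 0"
  shows
    "(compact (UNIV :: 'k::t2_space set) \<longrightarrow>
        (\<forall>(B :: (('k \<Rightarrow>\<^sub>C real) \<Rightarrow>\<^sub>L real) set) (A :: ('k \<Rightarrow>\<^sub>C real) set).
           boundary B \<longrightarrow> bounded A \<longrightarrow>
           (\<forall>x :: nat \<Rightarrow> ('k \<Rightarrow>\<^sub>C real). (\<forall>n. x n \<in> A) \<longrightarrow>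
              (\<Inter>k\<in>{1..}. {c + \<epsilon> *\<^sub>R u | c u.
                 c \<in> sigma_topology B closure_of (convex hull {x n | n. n \<ge> k}) \<and>
                 u \<in> cball 0 1}) \<noteq> {}) \<longrightarrow>
           delta_WRC (2 * \<epsilon>) A)) \<and>
     (\<forall>(B :: ('i ell1 \<Rightarrow>\<^sub>L real) set) (A :: 'i ell1 set).
        boundary B \<longrightarrow> bounded A \<longrightarrow>
        (\<forall>x :: nat \<Rightarrow> 'i ell1. (\<forall>n. x n \<in> A) \<longrightarrow>
           (\<Inter>k\<in>{1..}. {c + \<epsilon> *\<^sub>R u | c u.
              c \<in> sigma_topology B closure_of (convex hull {x n | n. n \<ge> k}) \<and>
              u \<in> cball 0 1}) \<noteq> {}) \<longrightarrow>
        delta_WRC (2 * \<epsilon>) A)"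
proof (intro conjI impI allI)
  fix B :: "(('k \<Rightarrow>\<^sub>C real) \<Rightarrow>\<^sub>L real) set" and A :: "('k \<Rightarrow>\<^sub>C real) set"
  assume "compact (UNIV :: 'k set)" "boundary B" "bounded A"
    and H: "\<forall>x :: nat \<Rightarrow> ('k \<Rightarrow>\<^sub>C real). (\<forall>n. x n \<in> A) \<longrightarrow>
      (\<Inter>k\<in>{1..}. {c + \<epsilon> *\<^sub>R u | c u.
        c \<in> sigma_topology B closure_of (convex hull {x n | n. n \<ge> k}) \<and> u \<in> cball 0 1}) \<noteq> {}"
  from this(1-3) assms show "delta_WRC (2 * \<epsilon>) A"
    by (rule delta_WRC_continuous_functions) (rule H[rule_format])
next
  fix B :: "('i ell1 \<Rightarrow>\<^sub>L real) set" and A :: "'i ell1 set"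
  assume "boundary B" "bounded A"
    and H: "\<forall>x :: nat \<Rightarrow> 'i ell1. (\<forall>n. x n \<in> A) \<longrightarrow>
      (\<Inter>k\<in>{1..}. {c + \<epsilon> *\<^sub>R u | c u.
        c \<in> sigma_topology B closure_of (convex hull {x n | n. n \<ge> k}) \<and> u \<in> cball 0 1}) \<noteq> {}"
  from this(1,2) assms show "delta_WRC (2 * \<epsilon>) A"
    by (rule delta_WRC_ell1) (rule H[rule_format])
qed

end
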